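(* Let $X$ be a quasi-Banach space. Then $X$ uniformly embeds into a Hilbert space if and only if $X$ coarsely embeds into a Hilbert space.
   Context: Vector spaces are over $\mathbb{R}$. A quasi-Banach space is a vector space $X$ with a complete quasi-norm $\|\cdot\|$ (a norm except that the triangle inequality is replaced by $\|x+y\|\le C(\|x\|+\|y\|)$ for some constant $C\ge 1$). By the Aoki–Rolewicz theorem there are $0<p\le 1$ and an equivalent quasi-norm $|||\cdot|||$ on $X$ with $|||x+y|||^p\le |||x|||^p+|||y|||^p$ for all $x,y\in X$. $X$ is regarded as a metric space with the metric $d(x,y)=|||x-y|||^p$; coarse and uniform embeddability do not depend on the choice of $p$ and $|||\cdot|||$. A (not necessarily continuous) map $f$ from a metric space $(X,d)$ to a metric space $(Y,\delta)$ is a coarse embedding if there exist two non-decreasing functions $\varphi_1,\varphi_2:[0,\infty)\to[0,\infty)$ such that (1) $\varphi_1(d(x,y))\le\delta(f(x),f(y))\le\varphi_2(d(x,y))$ for all $x,y\in X$, and (2) $\varphi_1(t)\to\infty$ as $t\to\infty$. A uniform embedding of $(X,d)$ into $(Y,\delta)$ is an injective map $f:X\to Y$ that is uniformly continuous and whose inverse $f^{-1}:f(X)\to X$ is uniformly continuous. $X$ coarsely (respectively uniformly) embeds into a Hilbert space if there is a coarse (respectively uniform) embedding of $X$ into some Hilbert space (not assumed separable). *)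

theory Defs
  imports "HOL-Analysis.Analysis" "HOL-Algebra.Module"
begin

section \<open>Quasi-Banach spaces\<close>

definition quasi_norm :: "('a::real_vector \<Rightarrow> real) \<Rightarrow> bool" where
  "quasi_norm q \<longleftrightarrow>
     (\<forall>x. 0 \<le> q x) \<and> (\<forall>x. q x = 0 \<longleftrightarrow> x = 0) \<and>
     (\<forall>c x. q (c *\<^sub>R x) = \<bar>c\<bar> * q x) \<and>
     (\<exists>C\<ge>1. \<forall>x y. q (x + y) \<le> C * (q x + q y))"

definition quasi_norm_complete :: "('a::real_vector \<Rightarrow> real) \<Rightarrow> bool" where
  "quasi_norm_complete q \<longleftrightarrow>
     (\<forall>s::nat \<Rightarrow> 'a. (\<forall>e>0. \<exists>N. \<forall>m\<ge>N. \<forall>n\<ge>N. q (s m - s n) < e) \<longrightarrow>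
        (\<exists>l. (\<lambda>n. q (s n - l)) \<longlonglongrightarrow> 0))"

definition quasi_Banach :: "('a::real_vector \<Rightarrow> real) \<Rightarrow> bool" where
  "quasi_Banach q \<longleftrightarrow> quasi_norm q \<and> quasi_norm_complete q"

definition equivalent_quasi_norms ::
  "('a::real_vector \<Rightarrow> real) \<Rightarrow> ('a \<Rightarrow> real) \<Rightarrow> bool" where
  "equivalent_quasi_norms q r \<longleftrightarrow> (\<exists>a>0. \<exists>b>0. \<forall>x. a * q x \<le> r x \<and> r x \<le> b * q x)"

text \<open>The exponent and the equivalent quasi-norm supplied by the Aoki--Rolewicz theorem.\<close>

definition Aoki_Rolewicz_renorming ::
  "('a::real_vector \<Rightarrow> real) \<Rightarrow> real \<Rightarrow> ('a \<Rightarrow> real) \<Rightarrow> bool" where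
  "Aoki_Rolewicz_renorming q p r \<longleftrightarrow>
     0 < p \<and> p \<le> 1 \<and> quasi_norm r \<and> equivalent_quasi_norms q r \<and>
     (\<forall>x y. r (x + y) powr p \<le> r x powr p + r y powr p)"

definition pnorm_metric :: "real \<Rightarrow> ('a::real_vector \<Rightarrow> real) \<Rightarrow> 'a metric" where
  "pnorm_metric p r = metric (UNIV, \<lambda>x y. r (x - y) powr p)"

text \<open>The constructor \<^const>\<open>metric\<close> is meaningful only on genuine metric spaces.\<close>

lemma Metric_space_pnorm:
  assumes "Aoki_Rolewicz_renorming q p r"
  shows "Metric_space UNIV (\<lambda>x y. r (x - y) powr p)"
proof
  have r0: "r x = 0 \<longleftrightarrow> x = 0" for x
    using assms by (simp add: Aoki_Rolewicz_renorming_def quasi_norm_def)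
  have hom: "r (c *\<^sub>R x) = \<bar>c\<bar> * r x" for c x
    using assms by (simp add: Aoki_Rolewicz_renorming_def quasi_norm_def)
  fix x y z
  show "0 \<le> r (x - y) powr p" by simp
  show "r (x - y) powr p = r (y - x) powr p"
    using hom[of "-1" "x - y"] by simp
  show "r (x - y) powr p = 0 \<longleftrightarrow> x = y"
    by (simp add: r0)
  have "r ((x - y) + (y - z)) powr p \<le> r (x - y) powr p + r (y - z) powr p"
    using assms unfolding Aoki_Rolewicz_renorming_def by blast
  then show "r (x - z) powr p \<le> r (x - y) powr p + r (y - z) powr p" by simp
qed


section \<open>Real Hilbert spaces on carrier sets\<close>

definition real_ring :: "real ring" where
  "real_ring = \<lparr>carrier = UNIV, monoid.mult = (*), one = 1, zero = 0, add = (+)\<rparr>"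

text \<open>\<^const>\<open>Metric_space\<close> demands symmetry and nonnegativity of the distance also off the carrier,
  hence the default value.\<close>

definition ip_dist :: "(real, 'h, 'm) module_scheme \<Rightarrow> ('h \<Rightarrow> 'h \<Rightarrow> real) \<Rightarrow> 'h \<Rightarrow> 'h \<Rightarrow> real" where
  "ip_dist V ip x y =
     (if x \<in> carrier V \<and> y \<in> carrier V then sqrt (ip (x \<ominus>\<^bsub>V\<^esub> y) (x \<ominus>\<^bsub>V\<^esub> y)) else 0)"

text \<open>The ring multiplication and unit that the record for \<open>V\<close> also contains play no role.\<close>

locale real_inner_product_space = module real_ring V for V (structure) +
  fixes ip :: "'h \<Rightarrow> 'h \<Rightarrow> real"
  assumes ip_commute: "\<lbrakk>x \<in> carrier V; y \<in> carrier V\<rbrakk> \<Longrightarrow> ip x y = ip y x"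
    and ip_add_left: "\<lbrakk>x \<in> carrier V; y \<in> carrier V; z \<in> carrier V\<rbrakk>
          \<Longrightarrow> ip (x \<oplus> y) z = ip x z + ip y z"
    and ip_smult_left: "\<lbrakk>x \<in> carrier V; y \<in> carrier V\<rbrakk> \<Longrightarrow> ip (c \<odot>\<^bsub>V\<^esub> x) y = c * ip x y"
    and ip_nonneg: "x \<in> carrier V \<Longrightarrow> 0 \<le> ip x x"
    and ip_definite: "\<lbrakk>x \<in> carrier V; ip x x = 0\<rbrakk> \<Longrightarrow> x = \<zero>"

locale real_Hilbert_space = real_inner_product_space +
  assumes ip_complete: "Metric_space.mcomplete (carrier V) (ip_dist V ip)"

definition Hilbert_metric :: "(real, 'h, 'm) module_scheme \<Rightarrow> ('h \<Rightarrow> 'h \<Rightarrow> real) \<Rightarrow> 'h metric" where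
  "Hilbert_metric V ip = metric (carrier V, ip_dist V ip)"

context real_inner_product_space
begin

lemma ip_add_right:
  "\<lbrakk>x \<in> carrier V; y \<in> carrier V; z \<in> carrier V\<rbrakk> \<Longrightarrow> ip x (y \<oplus> z) = ip x y + ip x z"
  using ip_commute ip_add_left by (metis M.add.m_closed)

lemma smult_in_carrier: "x \<in> carrier V \<Longrightarrow> c \<odot>\<^bsub>V\<^esub> x \<in> carrier V"
  using smult_closed[of c x] by (simp add: real_ring_def)

lemma ip_smult_right:
  "\<lbrakk>x \<in> carrier V; y \<in> carrier V\<rbrakk> \<Longrightarrow> ip x (c \<odot>\<^bsub>V\<^esub> y) = c * ip x y"
  using ip_commute ip_smult_left smult_in_carrier by metis

lemma ip_zero_left: "x \<in> carrier V \<Longrightarrow> ip \<zero> x = 0"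
  using ip_add_left[of \<zero> \<zero> x] by simp

lemma ip_minus_left: "\<lbrakk>x \<in> carrier V; y \<in> carrier V\<rbrakk> \<Longrightarrow> ip (\<ominus> x) y = - ip x y"
  using ip_add_left[of "\<ominus> x" x y] ip_zero_left[of y] by (simp add: M.l_neg)

lemma ip_minus_minus: "x \<in> carrier V \<Longrightarrow> ip (\<ominus> x) (\<ominus> x) = ip x x"
  using ip_minus_left[of x "\<ominus> x"] ip_minus_left[of x x] ip_commute[of x "\<ominus> x"] by simp

lemma ip_Cauchy_Schwarz:
  assumes x: "x \<in> carrier V" and y: "y \<in> carrier V"
  shows "(ip x y)\<^sup>2 \<le> ip x x * ip y y"
proof -
  have exp: "0 \<le> a\<^sup>2 * ip x x + 2 * a * b * ip x y + b\<^sup>2 * ip y y" for a b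
  proof -
    let ?u = "a \<odot>\<^bsub>V\<^esub> x" and ?v = "b \<odot>\<^bsub>V\<^esub> y"
    have uv: "?u \<in> carrier V" "?v \<in> carrier V"
      using x y smult_in_carrier by auto
    have "0 \<le> ip (?u \<oplus> ?v) (?u \<oplus> ?v)"
      using uv by (intro ip_nonneg) simp
    also have "\<dots> = ip ?u ?u + 2 * ip ?u ?v + ip ?v ?v"
      using uv ip_commute[of ?u ?v] by (simp add: ip_add_left ip_add_right)
    also have "\<dots> = a\<^sup>2 * ip x x + 2 * a * b * ip x y + b\<^sup>2 * ip y y"
      using x y uv by (simp add: ip_smult_left ip_smult_right power2_eq_square)
    finally show ?thesis .
  qed
  show ?thesis
  proof (cases "ip y y = 0")
    case True
    then have "y = \<zero>" using ip_definite y by blast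
    then have "ip x y = 0" using ip_zero_left[OF x] ip_commute[OF x y] by simp
    then show ?thesis using True by simp
  next
    case False
    then have pos: "0 < ip y y" using ip_nonneg[OF y] by simp
    have "0 \<le> ip y y * (ip x x * ip y y - (ip x y)\<^sup>2)"
      using exp[of "ip y y" "- ip x y"] by (simp add: power2_eq_square algebra_simps)
    then show ?thesis using pos by (simp add: zero_le_mult_iff)
  qed
qed

lemma ip_triangle:
  assumes x: "x \<in> carrier V" and y: "y \<in> carrier V"
  shows "sqrt (ip (x \<oplus> y) (x \<oplus> y)) \<le> sqrt (ip x x) + sqrt (ip y y)"
proof (rule real_le_lsqrt)
  have "\<bar>ip x y\<bar> = sqrt ((ip x y)\<^sup>2)" by simp
  also have "\<dots> \<le> sqrt (ip x x * ip y y)"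
    using ip_Cauchy_Schwarz[OF x y] by (rule real_sqrt_le_mono)
  finally have cs: "ip x y \<le> sqrt (ip x x) * sqrt (ip y y)"
    by (simp add: real_sqrt_mult)
  have "ip (x \<oplus> y) (x \<oplus> y) = ip x x + 2 * ip x y + ip y y"
    using x y ip_commute[of x y] by (simp add: ip_add_left ip_add_right)
  also have "\<dots> \<le> (sqrt (ip x x) + sqrt (ip y y))\<^sup>2"
    using cs ip_nonneg[OF x] ip_nonneg[OF y] by (simp add: power2_sum)
  finally show "ip (x \<oplus> y) (x \<oplus> y) \<le> (sqrt (ip x x) + sqrt (ip y y))\<^sup>2" .
qed (use ip_nonneg x y in auto)

lemma Metric_space_ip_dist: "Metric_space (carrier V) (ip_dist V ip)"
proof (rule Metric_space.intro)
  show "0 \<le> ip_dist V ip x y" for x y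
    by (simp add: ip_dist_def ip_nonneg)
  show "ip_dist V ip x y = ip_dist V ip y x" for x y
  proof (cases "x \<in> carrier V \<and> y \<in> carrier V")
    case True
    then have "\<ominus> (x \<ominus> y) = y \<ominus> x"
      by (metis M.add.inv_closed M.minus_minus M.minus_eq M.add.inv_mult_group)
    then show ?thesis
      using True ip_minus_minus[of "x \<ominus> y"] by (simp add: ip_dist_def)
  qed (auto simp: ip_dist_def)
  show "(ip_dist V ip x y = 0) = (x = y)" if xy: "x \<in> carrier V" "y \<in> carrier V" for x y
  proof
    assume "ip_dist V ip x y = 0"
    then have "x \<ominus> y = \<zero>" using xy ip_definite[of "x \<ominus> y"] by (simp add: ip_dist_def)
    then have "\<ominus> (\<ominus> y) = x"
      using xy by (intro M.minus_equality) (simp_all add: M.minus_eq)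
    then show "x = y" using xy by simp
  next
    assume "x = y"
    then show "ip_dist V ip x y = 0" using xy ip_zero_left[of \<zero>]
      by (simp add: ip_dist_def M.minus_eq M.r_neg)
  qed
  show "ip_dist V ip x z \<le> ip_dist V ip x y + ip_dist V ip y z"
    if xyz: "x \<in> carrier V" "y \<in> carrier V" "z \<in> carrier V" for x y z
  proof -
    have "(x \<ominus> y) \<oplus> (y \<ominus> z) = x \<ominus> z"
      using xyz by (simp add: M.minus_eq M.a_assoc M.r_neg1 M.l_neg)
    then show ?thesis
      using ip_triangle[of "x \<ominus> y" "y \<ominus> z"] xyz by (simp add: ip_dist_def)
  qed
qed

end


section \<open>Coarse and uniform embeddings\<close>

definition coarse_embedding :: "'a metric \<Rightarrow> 'b metric \<Rightarrow> ('a \<Rightarrow> 'b) \<Rightarrow> bool" where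
  "coarse_embedding X Y f \<longleftrightarrow>
     f \<in> mspace X \<rightarrow> mspace Y \<and>
     (\<exists>\<phi>1 \<phi>2 :: real \<Rightarrow> real.
        \<phi>1 \<in> {0..} \<rightarrow> {0..} \<and> \<phi>2 \<in> {0..} \<rightarrow> {0..} \<and>
        mono_on {0..} \<phi>1 \<and> mono_on {0..} \<phi>2 \<and>
        (\<forall>x\<in>mspace X. \<forall>y\<in>mspace X.
           \<phi>1 (mdist X x y) \<le> mdist Y (f x) (f y) \<and>
           mdist Y (f x) (f y) \<le> \<phi>2 (mdist X x y)) \<and>
        filterlim \<phi>1 at_top at_top)"

definition uniform_embedding :: "'a metric \<Rightarrow> 'b metric \<Rightarrow> ('a \<Rightarrow> 'b) \<Rightarrow> bool" where
  "uniform_embedding X Y f \<longleftrightarrow>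
     inj_on f (mspace X) \<and> uniformly_continuous_map X Y f \<and>
     uniformly_continuous_map (submetric Y (f ` mspace X)) X (inv_into (mspace X) f)"

text \<open>HOL has no quantifier over types, so ``some Hilbert space'' ranges over the Hilbert spaces whose
  carrier is a subset of \<open>'u + ('a \<Rightarrow> real)\<close>. The type \<open>'u\<close> is arbitrary, so that no Hilbert space is
  excluded. The summand \<open>'a \<Rightarrow> real\<close> provides enough room for every choice of \<open>'u\<close>: if \<open>X\<close>, with points
  in \<open>'a\<close>, embeds into any Hilbert space, then it embeds into the closed linear span of its image;
  that span has an orthonormal basis \<open>B\<close> no larger than \<open>'a\<close>, so a copy of it (the square-summable
  families on \<open>B\<close>) lives inside \<open>'a \<Rightarrow> real\<close>.\<close>

definition coarsely_embeds_Hilbert :: "'u itself \<Rightarrow> 'a metric \<Rightarrow> bool" where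
  "coarsely_embeds_Hilbert U X \<longleftrightarrow>
     (\<exists>(V :: (real, 'u + ('a \<Rightarrow> real)) module) ip f.
        real_Hilbert_space V ip \<and> coarse_embedding X (Hilbert_metric V ip) f)"

definition uniformly_embeds_Hilbert :: "'u itself \<Rightarrow> 'a metric \<Rightarrow> bool" where
  "uniformly_embeds_Hilbert U X \<longleftrightarrow>
     (\<exists>(V :: (real, 'u + ('a \<Rightarrow> real)) module) ip f.
        real_Hilbert_space V ip \<and> uniform_embedding X (Hilbert_metric V ip) f)"

end

theory Submission
  imports Defs "HOL-Analysis.Finite_Function_Topology"
begin

text \<open>Maps into Hilbert spaces are replaced by the kernels \<open>N x y = \<parallel>f x - f y\<parallel>\<^sup>2\<close>, which are exactly the
  kernels of negative type.

  A uniform kernel is rescaled: \<open>\<Sum>k. 1 - exp (- N (a\<^sub>k x) (a\<^sub>k y))\<close> with \<open>a\<^sub>k\<close> small enough converges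
  uniformly on bounded distances, and each term is bounded away from 0 at large distances, so the sum
  is a coarse kernel.

  For a coarse kernel, \<open>\<Sum>k. 1 - exp (- b\<^sub>k N)\<close> with \<open>b\<^sub>k\<close> small enough is again coarse and at most
  \<open>d + 3\<close>. Minty's extension theorem for Hoelder maps of exponent 1/2 turns it into a coarse kernel \<open>M\<close>
  with \<open>M \<le> d\<close> at all distances, and \<open>\<Sum>k. 4\<^sup>-\<^sup>k M (2\<^sup>k x) (2\<^sup>k y)\<close> is a uniform kernel.\<close>

section \<open>Kernels of positive and of negative type\<close>

text \<open>Kernels turn Hilbert sums of maps into series and limits of maps into pointwise limits.
  The truncation \<open>1 - exp (- N)\<close> is what lets infinitely many terms be added: each is
  at most 1, and a linear bound on the sum comes from counting the terms that are not yet
  geometrically small. The delicate direction starts from a coarse kernel. It may jump at the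
  diagonal, and then so does every series of its dilates with positive weights. A bound by
  \<open>d\<close> at all distances repairs this: dilation by \<open>2^k\<close> multiplies
  \<open>d\<close> by \<open>2^(k p)\<close>, at most \<open>2^k\<close>, and the weight
  \<open>4^-k\<close> still leaves a geometric factor. The exponent 1/2 is natural in the extension
  step: for squared distances bounded by \<open>D\<close>, the triangle inequality of
  \<open>D\<close> supplies the condition under which the relevant balls meet.\<close>

definition quad :: "('a \<Rightarrow> 'a \<Rightarrow> real) \<Rightarrow> 'a set \<Rightarrow> ('a \<Rightarrow> real) \<Rightarrow> real" where
  "quad K F c = (\<Sum>x\<in>F. \<Sum>y\<in>F. c x * c y * K x y)"

definition pos_def_on :: "'a set \<Rightarrow> ('a \<Rightarrow> 'a \<Rightarrow> real) \<Rightarrow> bool" where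
  "pos_def_on A K \<longleftrightarrow> (\<forall>x\<in>A. \<forall>y\<in>A. K x y = K y x) \<and>
     (\<forall>F c. finite F \<longrightarrow> F \<subseteq> A \<longrightarrow> 0 \<le> quad K F c)"

text \<open>The conditionally negative definite kernels of Schoenberg. Localising to
  \<open>A\<close> leaves the values of \<open>N\<close> elsewhere free, as the extension of partial
  kernels requires.\<close>

definition neg_type_on :: "'a set \<Rightarrow> ('a \<Rightarrow> 'a \<Rightarrow> real) \<Rightarrow> bool" where
  "neg_type_on A N \<longleftrightarrow> (\<forall>x\<in>A. N x x = 0) \<and> (\<forall>x\<in>A. \<forall>y\<in>A. N x y = N y x) \<and>
     (\<forall>F c. finite F \<longrightarrow> F \<subseteq> A \<longrightarrow> sum c F = 0 \<longrightarrow> quad N F c \<le> 0)"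

lemma quad_cong:
  assumes "\<And>x y. x \<in> F \<Longrightarrow> y \<in> F \<Longrightarrow> c x * c y * K x y = d x * d y * L x y"
  shows "quad K F c = quad L F d"
  unfolding quad_def using assms by (intro sum.cong refl)

lemma quad_mono_neutral:
  assumes "finite G" "F \<subseteq> G" "\<And>x. x \<in> G - F \<Longrightarrow> c x = 0"
  shows "quad K G c = quad K F c"
proof -
  have "quad K G c = (\<Sum>x\<in>F. \<Sum>y\<in>G. c x * c y * K x y)"
    unfolding quad_def using assms by (intro sum.mono_neutral_right) auto
  also have "\<dots> = quad K F c"
    unfolding quad_def using assms by (intro sum.cong refl sum.mono_neutral_right) auto
  finally show ?thesis .
qed

lemma quad_insert:
  assumes "finite F" "z \<notin> F" "\<And>x. x \<in> F \<Longrightarrow> K x z = K z x"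
  shows "quad K (insert z F) c = (c z)\<^sup>2 * K z z + 2 * c z * (\<Sum>x\<in>F. c x * K z x) + quad K F c"
proof -
  have "(\<Sum>x\<in>F. c x * c z * K x z) = c z * (\<Sum>x\<in>F. c x * K z x)"
    using assms(3) by (simp add: sum_distrib_left mult_ac)
  moreover have "(\<Sum>x\<in>F. c z * c x * K z x) = c z * (\<Sum>x\<in>F. c x * K z x)"
    by (simp add: sum_distrib_left mult_ac)
  ultimately show ?thesis
    using assms(1,2) by (simp add: quad_def sum.distrib power2_eq_square)
qed

lemma quad_add: "quad (\<lambda>x y. K x y + L x y) F c = quad K F c + quad L F c"
  by (simp add: quad_def distrib_left sum.distrib)

lemma quad_scale: "quad (\<lambda>x y. a * K x y) F c = a * quad K F c"
  by (simp add: quad_def sum_distrib_left mult_ac)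

lemma quad_rank_one: "quad (\<lambda>x y. g x * g y) F c = (\<Sum>x\<in>F. c x * g x)\<^sup>2"
  by (simp add: quad_def power2_eq_square sum_product mult_ac)

lemma quad_tendsto:
  assumes "finite F" "\<And>x y. x \<in> F \<Longrightarrow> y \<in> F \<Longrightarrow> (\<lambda>n. K n x y) \<longlonglongrightarrow> L x y"
  shows "(\<lambda>n. quad (K n) F c) \<longlonglongrightarrow> quad L F c"
  unfolding quad_def by (intro tendsto_intros assms)

lemma neg_type_onD:
  assumes "neg_type_on A N"
  shows "x \<in> A \<Longrightarrow> N x x = 0" "x \<in> A \<Longrightarrow> y \<in> A \<Longrightarrow> N x y = N y x"
    "finite F \<Longrightarrow> F \<subseteq> A \<Longrightarrow> sum c F = 0 \<Longrightarrow> quad N F c \<le> 0"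
  using assms unfolding neg_type_on_def by blast+

lemma neg_type_on_subset: "neg_type_on A N \<Longrightarrow> B \<subseteq> A \<Longrightarrow> neg_type_on B N"
  unfolding neg_type_on_def by (meson subset_iff)

lemma neg_type_on_nonneg:
  assumes "neg_type_on A N" "x \<in> A" "y \<in> A"
  shows "0 \<le> N x y"
proof (cases "x = y")
  case False
  have "quad N {x, y} (\<lambda>u. if u = x then 1 else -1) \<le> 0"
    using assms False unfolding neg_type_on_def by auto
  then show ?thesis using assms False by (simp add: quad_def neg_type_on_def)
qed (use assms in \<open>simp add: neg_type_on_def\<close>)

text \<open>The weights 1, -2, 1 at \<open>x\<close>, \<open>y\<close>, \<open>z\<close> give the
  form \<open>2 * N x z - 4 * N x y - 4 * N y z\<close>. For points of a Hilbert space this is the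
  parallelogram law.\<close>

lemma neg_type_on_quasi_triangle:
  assumes "neg_type_on A N" "x \<in> A" "y \<in> A" "z \<in> A"
  shows "N x z \<le> 2 * N x y + 2 * N y z"
proof -
  note nn = neg_type_on_nonneg[OF assms(1)]
  have 0: "N u u = 0" if "u \<in> A" for u using assms(1) that by (simp add: neg_type_on_def)
  consider "x = y" | "y = z" | "x = z" | "x \<noteq> y" "y \<noteq> z" "x \<noteq> z" by blast
  then show ?thesis
  proof cases
    case 4
    let ?c = "\<lambda>u. if u = y then -2 else 1 :: real"
    have "quad N {x, y, z} ?c \<le> 0"
      using assms 4 unfolding neg_type_on_def by auto
    moreover have "N y x = N x y" "N z x = N x z" "N z y = N y z"
      using assms by (auto simp: neg_type_on_def)
    ultimately show ?thesis using 4 0 assms by (simp add: quad_def)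
  qed (use assms nn 0 in auto)
qed

text \<open>If \<open>K\<close> is an inner product, the new kernel is the squared distance. The
  diagonal terms disappear because they factor through \<open>sum c F = 0\<close>, leaving
  \<open>- 2 * quad K F c\<close>.\<close>

lemma neg_type_of_pos_def:
  assumes "pos_def_on A K"
  shows "neg_type_on A (\<lambda>x y. K x x + K y y - 2 * K x y)"
  unfolding neg_type_on_def
proof (intro conjI allI impI ballI)
  fix F :: "'a set" and c :: "'a \<Rightarrow> real" assume F: "finite F" "F \<subseteq> A" "sum c F = 0"
  have "quad (\<lambda>x y. K x x + K y y - 2 * K x y) F c
      = (\<Sum>x\<in>F. \<Sum>y\<in>F. c x * K x x * c y) + (\<Sum>x\<in>F. \<Sum>y\<in>F. c x * (c y * K y y)) - 2 * quad K F c"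
    by (simp add: quad_def sum.distrib sum_subtractf algebra_simps sum_distrib_left)
  also have "\<dots> = - 2 * quad K F c"
    by (simp flip: sum_product add: F)
  finally show "quad (\<lambda>x y. K x x + K y y - 2 * K x y) F c \<le> 0"
    using assms F by (simp add: pos_def_on_def)
qed (use assms in \<open>auto simp: pos_def_on_def\<close>)

text \<open>With \<open>N\<close> a squared distance, this kernel is twice the inner product after
  \<open>z\<close> is moved to the origin. Its row at \<open>z\<close> vanishes, so the weight at
  \<open>z\<close> can be chosen to make the total zero without changing the form.\<close>

lemma pos_def_of_neg_type:
  fixes N :: "'a \<Rightarrow> 'a \<Rightarrow> real"
  assumes "neg_type_on UNIV N"
  shows "pos_def_on UNIV (\<lambda>x y. N x z + N y z - N x y)"
  unfolding pos_def_on_def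
proof (intro conjI allI impI ballI)
  let ?K = "\<lambda>x y. N x z + N y z - N x y"
  have sym: "N x y = N y x" for x y using assms by (simp add: neg_type_on_def)
  then show "?K x y = ?K y x" for x y by simp
  fix F :: "'a set" and c :: "'a \<Rightarrow> real" assume F: "finite F"
  define c0 where "c0 x = (if x \<in> F then c x else 0)" for x
  define c1 where "c1 x = c0 x - (if x = z then sum c F else 0)" for x
  let ?G = "insert z F"
  have "sum c0 ?G = sum c F"
  proof -
    have "sum c0 ?G = sum c0 F" using F by (intro sum.mono_neutral_right) (auto simp: c0_def)
    then show ?thesis by (simp add: c0_def)
  qed
  then have c1: "sum c1 ?G = 0" using F by (simp add: c1_def sum_subtractf sum.delta)
  have "N z z = 0" using assms by (simp add: neg_type_on_def)
  then have "quad ?K ?G c1 = quad ?K ?G c0"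
    using sym by (intro quad_cong) (auto simp: c1_def)
  also have "\<dots> = quad ?K F c0"
    using F by (intro quad_mono_neutral) (auto simp: c0_def)
  also have "\<dots> = quad ?K F c"
    by (intro quad_cong) (auto simp: c0_def)
  finally have "quad ?K F c = quad ?K ?G c1" ..
  also have "\<dots> = (\<Sum>x\<in>?G. \<Sum>y\<in>?G. c1 x * N x z * c1 y) + (\<Sum>x\<in>?G. \<Sum>y\<in>?G. c1 x * (c1 y * N y z)) - quad N ?G c1"
    unfolding quad_def sum.distrib[symmetric] sum_subtractf[symmetric]
    by (intro sum.cong refl) (simp add: algebra_simps)
  also have "\<dots> = - quad N ?G c1"
    by (simp only: sum_product[symmetric] c1 mult_zero_left mult_zero_right add_0_left diff_0)
  finally have "quad ?K F c = - quad N ?G c1" .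
  moreover have "quad N ?G c1 \<le> 0" using assms F c1 unfolding neg_type_on_def by blast
  ultimately show "0 \<le> quad ?K F c" by simp
qed

section \<open>Gram representations, Schur products and exponentials of kernels\<close>

lemma pos_def_vanishing_row:
  assumes K: "pos_def_on A K" and "z \<in> A" "x \<in> A" "K z z = 0"
  shows "K z x = 0"
proof (cases "x = z")
  case False
  \<comment> \<open>Since \<open>K z z = 0\<close>, the form with weights \<open>t\<close> and 1 is
    affine in \<open>t\<close>; an affine function bounded below on the whole line has slope
    0.\<close>
  have *: "0 \<le> 2 * t * K z x + K x x" for t
  proof -
    have "0 \<le> quad K {z, x} (\<lambda>u. if u = z then t else 1)"
      using K assms by (simp add: pos_def_on_def)
    moreover have "K x z = K z x" using assms by (simp add: pos_def_on_def)
    ultimately show ?thesis using False assms by (simp add: quad_def algebra_simps)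
  qed
  show ?thesis
  proof (rule ccontr)
    assume "K z x \<noteq> 0"
    then show False using *[of "- (K x x + 1) / (2 * K z x)"] by (simp add: field_simps)
  qed
qed (use assms in simp)

text \<open>Cholesky factorisation by induction on the points. The row of \<open>z\<close> divided
  by \<open>sqrt (K z z)\<close> is one coordinate, and the Schur complement \<open>K'\<close>
  supplies the others. If \<open>K z z = 0\<close>, the row vanishes and division by zero makes
  \<open>K' = K\<close>, so both cases run together.\<close>

lemma finite_pos_def_gram:
  assumes "finite F" "pos_def_on F K"
  shows "\<exists>(n::nat) a. \<forall>x\<in>F. \<forall>y\<in>F. K x y = (\<Sum>k<n. a k x * a k y)"
  using assms
proof (induction F arbitrary: K rule: finite_induct)
  case (insert z F)
  let ?s = "K z z"
  have sym: "K x y = K y x" if "x \<in> insert z F" "y \<in> insert z F" for x y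
    using insert.prems that unfolding pos_def_on_def by blast
  define K' where "K' x y = K x y - K z x * K z y / ?s" for x y
  have "0 \<le> quad K {z} (\<lambda>_. 1)"
    using insert.prems unfolding pos_def_on_def by blast
  then have s0: "0 \<le> ?s" by (simp add: quad_def)
  have row0: "K z x = 0" if "?s = 0" "x \<in> insert z F" for x
    using pos_def_vanishing_row[OF insert.prems] that by blast
  have "pos_def_on F K'"
    unfolding pos_def_on_def
  proof (intro conjI ballI allI impI)
    show "K' x y = K' y x" if "x \<in> F" "y \<in> F" for x y
      using sym that by (simp add: K'_def mult_ac)
    fix G and c :: "'a \<Rightarrow> real" assume G: "finite G" "G \<subseteq> F"
    define s where "s = (\<Sum>x\<in>G. c x * K z x)"
    \<comment> \<open>This weight at \<open>z\<close> minimises the form of \<open>K\<close> when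
      the other weights are fixed (it is 0 if \<open>K z z = 0\<close>); the minimum is the form of
      \<open>K'\<close>.\<close>
    define d where "d = c(z := - s / ?s)"
    have zG: "z \<notin> G" using G insert by auto
    have 1: "(\<Sum>x\<in>G. d x * K z x) = s"
      unfolding s_def by (rule sum.cong) (use zG in \<open>auto simp: d_def\<close>)
    have 2: "quad K G d = quad K G c"
      by (rule quad_cong) (use zG in \<open>auto simp: d_def\<close>)
    have "0 \<le> quad K (insert z G) d"
      using insert.prems G unfolding pos_def_on_def by (meson finite.insertI insert_mono)
    also have "\<dots> = (d z)\<^sup>2 * ?s + 2 * d z * s + quad K G c"
      using quad_insert[of G z K d] G zG sym 1 2 by (simp add: subset_iff)
    also have "\<dots> = quad K G c - s\<^sup>2 / ?s"
      by (cases "?s = 0") (simp_all add: d_def power2_eq_square field_simps)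
    also have "\<dots> = quad K G c + (- (1 / ?s)) * quad (\<lambda>x y. K z x * K z y) G c"
      by (simp add: quad_rank_one s_def)
    also have "\<dots> = quad K' G c"
      unfolding quad_scale[symmetric] quad_add[symmetric] K'_def by (intro quad_cong) simp
    finally show "0 \<le> quad K' G c" .
  qed
  from insert.IH[OF this] obtain n a where na:
    "\<And>x y. x \<in> F \<Longrightarrow> y \<in> F \<Longrightarrow> K' x y = (\<Sum>k<(n::nat). a k x * a k y)" by blast
  define b where "b k x = (if k = n then K z x / sqrt ?s else if x = z then 0 else a k x)" for k x
  have "K x y = (\<Sum>k<Suc n. b k x * b k y)" if xy: "x \<in> insert z F" "y \<in> insert z F" for x y
  proof -
    have "(\<Sum>k<n. b k x * b k y) = K' x y"
    proof (cases "x = z \<or> y = z")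
      case True
      have "K' x y = 0"
        using True row0 xy sym[OF xy] by (cases "?s = 0") (auto simp: K'_def)
      then show ?thesis using True by (auto simp: b_def intro!: sum.neutral)
    next
      case False
      then show ?thesis using xy na[of x y] by (simp add: b_def)
    qed
    then show ?thesis using s0 by (simp add: b_def K'_def)
  qed
  then show ?case by blast
qed simp

text \<open>Schur product theorem. With \<open>K\<close> written as a finite Gram matrix of
  coordinates \<open>a k\<close>, the form of the product is a sum of forms of \<open>L\<close> with
  weights \<open>c x * a k x\<close>.\<close>

lemma pos_def_on_mult:
  assumes "pos_def_on A K" "pos_def_on A L"
  shows "pos_def_on A (\<lambda>x y. K x y * L x y)"
  unfolding pos_def_on_def
proof (intro conjI allI impI ballI)
  fix F :: "'a set" and c :: "'a \<Rightarrow> real" assume F: "finite F" "F \<subseteq> A"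
  have "pos_def_on F K" using assms(1) F unfolding pos_def_on_def by (meson subset_iff)
  from finite_pos_def_gram[OF F(1) this] obtain n a where na:
    "\<And>x y. x \<in> F \<Longrightarrow> y \<in> F \<Longrightarrow> K x y = (\<Sum>k<(n::nat). a k x * a k y)" by blast
  have "quad (\<lambda>x y. K x y * L x y) F c
      = (\<Sum>x\<in>F. \<Sum>y\<in>F. \<Sum>k<n. (c x * a k x) * (c y * a k y) * L x y)"
    unfolding quad_def
    by (intro sum.cong refl) (simp add: na sum_distrib_left sum_distrib_right mult_ac)
  also have "\<dots> = (\<Sum>x\<in>F. \<Sum>k<n. \<Sum>y\<in>F. (c x * a k x) * (c y * a k y) * L x y)"
    by (intro sum.cong refl sum.swap)
  also have "\<dots> = (\<Sum>k<n. \<Sum>x\<in>F. \<Sum>y\<in>F. (c x * a k x) * (c y * a k y) * L x y)"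
    by (rule sum.swap)
  also have "\<dots> = (\<Sum>k<n. quad L F (\<lambda>x. c x * a k x))"
    by (simp add: quad_def)
  also have "\<dots> \<ge> 0"
    using assms(2) F by (intro sum_nonneg) (simp add: pos_def_on_def)
  finally show "0 \<le> quad (\<lambda>x y. K x y * L x y) F c" .
next
  show "K x y * L x y = K y x * L y x" if "x \<in> A" "y \<in> A" for x y
    using assms that unfolding pos_def_on_def by metis
qed

lemma pos_def_on_one: "pos_def_on (A :: 'a set) (\<lambda>x y. 1)"
  using quad_rank_one[where g = "\<lambda>_::'a. 1"] by (auto simp: pos_def_on_def)

lemma pos_def_on_power: "pos_def_on A K \<Longrightarrow> pos_def_on A (\<lambda>x y. K x y ^ n)"
  by (induction n) (simp_all add: pos_def_on_one pos_def_on_mult)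

text \<open>The exponential is the pointwise limit of \<open>(1 + K x y / n) ^ n\<close>, and these
  powers are positive definite by Schur products.\<close>

lemma pos_def_on_exp:
  assumes K: "pos_def_on A K"
  shows "pos_def_on A (\<lambda>x y. exp (K x y))"
  unfolding pos_def_on_def
proof (intro conjI allI impI ballI)
  show "exp (K x y) = exp (K y x)" if "x \<in> A" "y \<in> A" for x y
    using K that unfolding pos_def_on_def by metis
  fix F :: "'a set" and c :: "'a \<Rightarrow> real" assume F: "finite F" "F \<subseteq> A"
  have "pos_def_on A (\<lambda>x y. 1 + (1 / real n) * K x y)" for n
    unfolding pos_def_on_def quad_add quad_scale
    using K pos_def_on_one[of A] by (auto simp: pos_def_on_def intro!: add_nonneg_nonneg)
  then have "0 \<le> quad (\<lambda>x y. (1 + K x y / real n) ^ n) F c" for n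
    using pos_def_on_power[of A _ n] F by (simp add: pos_def_on_def)
  moreover have "(\<lambda>n. quad (\<lambda>x y. (1 + K x y / real n) ^ n) F c) \<longlonglongrightarrow> quad (\<lambda>x y. exp (K x y)) F c"
    using F by (intro quad_tendsto tendsto_exp_limit_sequentially)
  ultimately show "0 \<le> quad (\<lambda>x y. exp (K x y)) F c"
    by (intro LIMSEQ_le_const) auto
qed

text \<open>Up to factors depending on \<open>x\<close> alone and on \<open>y\<close> alone, which
  the weights absorb, \<open>exp (- N x y)\<close> is the exponential of the positive definite
  kernel based at a point, here \<open>undefined\<close>. The constant 1 contributes
  \<open>(sum c F)\<^sup>2 = 0\<close>.\<close>

lemma neg_type_one_minus_exp:
  fixes N :: "'a \<Rightarrow> 'a \<Rightarrow> real"
  assumes N: "neg_type_on UNIV N"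
  shows "neg_type_on UNIV (\<lambda>x y. 1 - exp (- N x y))"
  unfolding neg_type_on_def
proof (intro conjI allI impI ballI)
  show "1 - exp (- N x x) = 0" "1 - exp (- N x y) = 1 - exp (- N y x)" for x y
    using N by (simp_all add: neg_type_on_def)
  fix F :: "'a set" and c :: "'a \<Rightarrow> real" assume F: "finite F" "sum c F = 0"
  let ?K = "\<lambda>x y. N x undefined + N y undefined - N x y"
  have "quad (\<lambda>x y. exp (- N x y)) F c = quad (\<lambda>x y. exp (?K x y)) F (\<lambda>x. c x * exp (- N x undefined))"
    by (intro quad_cong) (simp add: exp_add exp_diff exp_minus field_simps)
  also have "\<dots> \<ge> 0"
    using pos_def_on_exp[OF pos_def_of_neg_type[OF N]] F unfolding pos_def_on_def by blast
  finally have "0 \<le> quad (\<lambda>x y. exp (- N x y)) F c" .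
  moreover have "quad (\<lambda>x y. 1 - exp (- N x y)) F c = (sum c F)\<^sup>2 + (-1) * quad (\<lambda>x y. exp (- N x y)) F c"
    using quad_rank_one[of "\<lambda>_. 1" F c] quad_add[of "\<lambda>_ _. 1" "\<lambda>x y. - 1 * exp (- N x y)" F c]
    by (simp add: quad_scale[of "- 1", simplified])
  ultimately show "quad (\<lambda>x y. 1 - exp (- N x y)) F c \<le> 0"
    using F by simp
qed

section \<open>Operations preserving negative type\<close>

lemma neg_type_scale:
  assumes "neg_type_on A N" "0 \<le> a"
  shows "neg_type_on A (\<lambda>x y. a * N x y)"
  unfolding neg_type_on_def quad_scale
proof (intro conjI allI impI ballI)
  show "a * quad N F c \<le> 0" if "finite F" "F \<subseteq> A" "sum c F = 0" for F c
    using assms that by (simp add: neg_type_on_def mult_nonneg_nonpos)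
qed (use assms in \<open>auto simp: neg_type_on_def\<close>)

text \<open>In terms of maps this is a Hilbert sum of countably many maps. The sign passes to the
  limit because each form involves finitely many values.\<close>

lemma neg_type_suminf:
  assumes N: "\<And>k::nat. neg_type_on A (N k)" and summ: "\<And>x y. x \<in> A \<Longrightarrow> y \<in> A \<Longrightarrow> summable (\<lambda>k. N k x y)"
  shows "neg_type_on A (\<lambda>x y. suminf (\<lambda>k. N k x y))"
  unfolding neg_type_on_def
proof (intro conjI allI impI ballI)
  show "suminf (\<lambda>k. N k x x) = 0" "suminf (\<lambda>k. N k x y) = suminf (\<lambda>k. N k y x)" if "x \<in> A" "y \<in> A" for x y
    using N that by (simp_all add: neg_type_on_def)
  fix F :: "'a set" and c :: "'a \<Rightarrow> real" assume F: "finite F" "F \<subseteq> A" "sum c F = 0"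
  have le: "quad (\<lambda>x y. \<Sum>k<n. N k x y) F c \<le> 0" for n
  proof (induction n)
    case 0 then show ?case by (simp add: quad_def)
  next
    case (Suc n)
    then show ?case using N[of n] F by (simp add: quad_add neg_type_on_def add_nonpos_nonpos)
  qed
  have lim: "(\<lambda>n. quad (\<lambda>x y. \<Sum>k<n. N k x y) F c) \<longlonglongrightarrow> quad (\<lambda>x y. suminf (\<lambda>k. N k x y)) F c"
    using F summ by (intro quad_tendsto summable_LIMSEQ) auto
  show "quad (\<lambda>x y. suminf (\<lambda>k. N k x y)) F c \<le> 0"
    using le by (intro LIMSEQ_le_const2[OF lim]) auto
qed

lemma neg_type_pullback:
  assumes N: "neg_type_on (h ` A) N" and h: "inj_on h A"
  shows "neg_type_on A (\<lambda>x y. N (h x) (h y))"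
  unfolding neg_type_on_def
proof (intro conjI allI impI ballI)
  show "N (h x) (h x) = 0" "N (h x) (h y) = N (h y) (h x)" if "x \<in> A" "y \<in> A" for x y
    using N that by (auto simp: neg_type_on_def)
  fix F :: "'b set" and c :: "'b \<Rightarrow> real" assume F: "finite F" "F \<subseteq> A" "sum c F = 0"
  have hF: "inj_on h F" using h F(2) by (rule inj_on_subset)
  have "quad (\<lambda>x y. N (h x) (h y)) F c = quad N (h ` F) (c \<circ> the_inv_into F h)"
    by (simp add: quad_def sum.reindex[OF hF] the_inv_into_f_f[OF hF])
  moreover have "sum (c \<circ> the_inv_into F h) (h ` F) = 0"
    using F by (simp add: sum.reindex[OF hF] the_inv_into_f_f[OF hF])
  ultimately show "quad (\<lambda>x y. N (h x) (h y)) F c \<le> 0"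
    using N F by (simp add: neg_type_on_def image_mono)
qed

section \<open>Minty's extension theorem\<close>

text \<open>This expansion gives the variation of the form along segments of the simplex, and the
  form after the weight of one point has been spread over others.\<close>

lemma quad_lin_comb:
  assumes "\<And>x y. x \<in> F \<Longrightarrow> y \<in> F \<Longrightarrow> N x y = N y x"
  shows "quad N F (\<lambda>x. a * f x + b * g x)
    = a\<^sup>2 * quad N F f + 2 * a * b * (\<Sum>x\<in>F. f x * (\<Sum>y\<in>F. g y * N x y)) + b\<^sup>2 * quad N F g"
proof -
  let ?X = "\<Sum>x\<in>F. f x * (\<Sum>y\<in>F. g y * N x y)"
  have "(\<Sum>x\<in>F. \<Sum>y\<in>F. f y * g x * N x y) = (\<Sum>y\<in>F. \<Sum>x\<in>F. f y * g x * N x y)"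
    by (rule sum.swap)
  also have "\<dots> = ?X"
    unfolding sum_distrib_left using assms by (intro sum.cong refl) (simp add: mult_ac)
  finally have 1: "(\<Sum>x\<in>F. \<Sum>y\<in>F. f y * g x * N x y) = ?X" .
  have 2: "(\<Sum>x\<in>F. \<Sum>y\<in>F. f x * g y * N x y) = ?X"
    by (simp add: sum_distrib_left mult_ac)
  have "quad N F (\<lambda>x. a * f x + b * g x) = a\<^sup>2 * quad N F f
    + a * b * (\<Sum>x\<in>F. \<Sum>y\<in>F. f x * g y * N x y) + a * b * (\<Sum>x\<in>F. \<Sum>y\<in>F. f y * g x * N x y)
    + b\<^sup>2 * quad N F g"
    unfolding quad_def sum_distrib_left sum.distrib[symmetric]
    by (intro sum.cong refl) (simp add: power2_eq_square algebra_simps)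
  then show ?thesis using 1 2 by simp
qed

text \<open>Tychonoff's theorem, since the topology of a function type is the product
  topology.\<close>

lemma compact_PiE_UNIV:
  fixes S :: "'i \<Rightarrow> 'b::topological_space set"
  assumes "\<And>i. compact (S i)"
  shows "compact (PiE UNIV S)"
  using compactin_PiE[of "\<lambda>_. euclidean" UNIV S] assms by (simp add: euclidean_product_topology)

text \<open>Pinning the weights to 0 off \<open>I\<close> makes the simplex a closed subset of a
  product of compact sets.\<close>

lemma compact_simplex:
  assumes "finite I"
  shows "compact {l :: 'i \<Rightarrow> real. (\<forall>i\<in>I. 0 \<le> l i) \<and> (\<forall>i. i \<notin> I \<longrightarrow> l i = 0) \<and> sum l I = 1}"
    (is "compact ?S")
proof -
  let ?P = "PiE UNIV (\<lambda>i. if i \<in> I then {0..1} else {0 :: real})"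
  have "?S = ?P \<inter> {l. sum l I = 1}"
  proof (intro equalityI subsetI)
    fix l assume l: "l \<in> ?S"
    have "l i \<le> 1" if "i \<in> I" for i
      using member_le_sum[of i I l] l that assms by simp
    then show "l \<in> ?P \<inter> {l. sum l I = 1}" using l by auto
  next
    fix l assume l: "l \<in> ?P \<inter> {l. sum l I = 1}"
    have "l i \<in> (if i \<in> I then {0..1} else {0})" for i
      by (rule PiE_mem[of l UNIV]) (use l in auto)
    then have "0 \<le> l i" "i \<notin> I \<longrightarrow> l i = 0" for i
      by (metis atLeastAtMost_iff order_refl singletonD, metis singletonD)
    with l show "l \<in> ?S" by simp
  qed
  moreover have "compact ?P" by (intro compact_PiE_UNIV) auto
  moreover have "closed {l :: 'i \<Rightarrow> real. sum l I = 1}"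
    by (intro closed_Collect_eq continuous_intros continuous_on_product_coordinates)
  ultimately show ?thesis by (simp add: compact_Int_closed)
qed

text \<open>The kernel form of the statement that balls with centres \<open>f i\<close> and squared radii \<open>t i\<close> in a
  Hilbert space have a common point as soon as \<open>\<parallel>f i - f j\<parallel>\<^sup>2 \<le> t i + t j\<close>. The point is
  \<open>\<Sum>j. l j * f j\<close>, where \<open>l\<close> maximises a concave function over the simplex.\<close>

lemma simplex_point_in_balls:
  fixes N :: "'i \<Rightarrow> 'i \<Rightarrow> real"
  assumes I: "finite I" "I \<noteq> {}" and N: "neg_type_on I N"
    and t: "\<And>i. i \<in> I \<Longrightarrow> 0 \<le> t i" "\<And>i j. i \<in> I \<Longrightarrow> j \<in> I \<Longrightarrow> i \<noteq> j \<Longrightarrow> N i j \<le> t i + t j"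
  obtains l where "sum l I = 1" "\<And>i. i \<in> I \<Longrightarrow> (\<Sum>j\<in>I. l j * N i j) - quad N I l / 2 \<le> t i"
proof -
  define S where "S = {l :: 'i \<Rightarrow> real. (\<forall>i\<in>I. 0 \<le> l i) \<and> (\<forall>i. i \<notin> I \<longrightarrow> l i = 0) \<and> sum l I = 1}"
  \<comment> \<open>For squared distances of points \<open>f i\<close> and p the barycentre with
    weights \<open>l\<close>, \<open>D l\<close> is the sum of
    \<open>l i * (|f i - p|^2 - t i)\<close>. It is the dual function of minimising the maximum of
    \<open>|f i - p|^2 - t i\<close> over p.\<close>
  define D where "D l = quad N I l / 2 - (\<Sum>i\<in>I. l i * t i)" for l
  have N0: "N i i = 0" if "i \<in> I" for i using N that by (simp add: neg_type_on_def)
  have sym: "N i j = N j i" if "i \<in> I" "j \<in> I" for i j using N that by (simp add: neg_type_on_def)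
  obtain i0 where "i0 \<in> I" using I by blast
  then have "(\<lambda>i. if i = i0 then 1 else 0) \<in> S" using I by (auto simp: S_def)
  then have ne: "S \<noteq> {}" by blast
  have coord: "continuous_on S (\<lambda>l. l i)" for i
    by (rule continuous_on_subset[OF continuous_on_product_coordinates]) simp
  have cont: "continuous_on S D"
    unfolding D_def quad_def by (intro continuous_intros coord) auto
  obtain l where l: "l \<in> S" and max: "\<And>m. m \<in> S \<Longrightarrow> D m \<le> D l"
    using continuous_attains_sup[OF compact_simplex[OF I(1), folded S_def] ne cont] by blast
  let ?T = "\<Sum>i\<in>I. l i * t i" and ?Q = "quad N I l"
  \<comment> \<open>The pairwise hypothesis averaged over \<open>l\<close> yields
    \<open>D l \<le> 0\<close>. On the diagonal, \<open>N i i = 0\<close> takes its place.\<close>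
  have "?Q \<le> (\<Sum>i\<in>I. \<Sum>j\<in>I. (l i * t i) * l j + l i * (l j * t j))"
    unfolding quad_def
  proof (intro sum_mono)
    fix i j assume ij: "i \<in> I" "j \<in> I"
    have "N i j \<le> t i + t j" using ij t N0 by (cases "i = j") (auto simp: add_nonneg_nonneg)
    then have "l i * l j * N i j \<le> l i * l j * (t i + t j)"
      using l ij by (intro mult_left_mono) (auto simp: S_def)
    then show "l i * l j * N i j \<le> (l i * t i) * l j + l i * (l j * t j)" by (simp add: algebra_simps)
  qed
  also have "\<dots> = 2 * ?T"
    using l by (simp add: S_def sum.distrib flip: sum_product)
  finally have QT: "?Q \<le> 2 * ?T" .
  have "(\<Sum>j\<in>I. l j * N i j) - ?Q / 2 \<le> t i" if i: "i \<in> I" for i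
  proof -
    let ?r = "\<Sum>j\<in>I. l j * N i j"
    let ?e = "\<lambda>j. if j = i then 1 else 0 :: real"
    \<comment> \<open>\<open>l\<close> is compared with the point at parameter \<open>s\<close> on
      the segment to the vertex \<open>i\<close>. \<open>D\<close> is not larger there, and the
      difference divided by \<open>s\<close> is the left-hand side.\<close>
    have ineq: "(?r - t i - ?Q + ?T) + s * (?Q / 2 - ?r) \<le> 0" if s: "0 < s" "s \<le> 1" for s
    proof -
      let ?m = "\<lambda>j. (1 - s) * l j + s * ?e j"
      have "sum ?m I = (1 - s) * sum l I + s * sum ?e I"
        by (simp add: sum.distrib sum_distrib_left)
      then have "sum ?m I = 1" using l i I by (simp add: S_def)
      then have "?m \<in> S" using l s i by (auto simp: S_def)
      then have "D ?m \<le> D l" by (rule max)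
      moreover have "quad N I ?e = 0"
        using i I N0 by (simp add: quad_def if_distrib[of "\<lambda>x. x * _"] if_distrib[of "\<lambda>x. _ * x"] cong: if_cong)
      moreover have "(\<Sum>x\<in>I. l x * (\<Sum>y\<in>I. ?e y * N x y)) = ?r"
        using i I sym by (simp add: if_distrib[of "\<lambda>x. x * _"] cong: if_cong)
      moreover have "(\<Sum>j\<in>I. ?m j * t j) = (1 - s) * ?T + s * t i"
      proof -
        have "(\<Sum>j\<in>I. ?m j * t j) = (1 - s) * ?T + s * (\<Sum>j\<in>I. ?e j * t j)"
          by (simp add: algebra_simps sum.distrib sum_distrib_left sum_subtractf)
        then show ?thesis using i I by (simp add: if_distrib[of "\<lambda>x. x * _"] cong: if_cong)
      qed
      ultimately have "((1 - s)\<^sup>2 * ?Q + 2 * (1 - s) * s * ?r) / 2 - ((1 - s) * ?T + s * t i) \<le> ?Q / 2 - ?T"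
        using quad_lin_comb[of I N "1 - s" l s ?e] sym by (simp add: D_def)
      then have "s * ((?r - t i - ?Q + ?T) + s * (?Q / 2 - ?r)) \<le> 0"
        by (simp add: power2_eq_square field_simps)
      then show ?thesis using s by (simp add: mult_le_0_iff)
    qed
    have "(\<lambda>n. (?r - t i - ?Q + ?T) + (1 / real (Suc n)) * (?Q / 2 - ?r)) \<longlonglongrightarrow> (?r - t i - ?Q + ?T) + 0 * (?Q / 2 - ?r)"
      by (intro tendsto_intros LIMSEQ_Suc[OF lim_1_over_n])
    then have "(?r - t i - ?Q + ?T) + 0 * (?Q / 2 - ?r) \<le> 0"
      by (rule LIMSEQ_le_const2) (intro exI allI impI ineq; simp)
    \<comment> \<open>The limit says that \<open>?r - ?Q / 2 - t i\<close> is at most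
      \<open>?Q / 2 - ?T\<close>, which is nonpositive by \<open>QT\<close>.\<close>
    then show ?thesis using QT by simp
  qed
  with l show thesis by (intro that) (auto simp: S_def)
qed

text \<open>\<open>n i\<close> is the squared distance from the point \<open>i\<close> to the
  barycentre with weights \<open>l\<close>, so the extended kernel places \<open>z\<close> at that
  barycentre.\<close>

lemma neg_type_barycentric_extension:
  fixes N :: "'i \<Rightarrow> 'i \<Rightarrow> real"
  assumes I: "finite I" and z: "z \<notin> I" and N: "neg_type_on I N" and l: "sum l I = 1"
  defines "n \<equiv> \<lambda>i. (\<Sum>j\<in>I. l j * N i j) - quad N I l / 2"
  shows "neg_type_on (insert z I)
    (\<lambda>x y. if x = z then if y = z then 0 else n y else if y = z then n x else N x y)"
    (is "neg_type_on _ ?N")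
  unfolding neg_type_on_def
proof (intro conjI allI impI ballI)
  show "?N x x = 0" if "x \<in> insert z I" for x using N that by (auto simp: neg_type_on_def)
  have sym: "N i j = N j i" if "i \<in> I" "j \<in> I" for i j using N that by (simp add: neg_type_on_def)
  then show "?N x y = ?N y x" if "x \<in> insert z I" "y \<in> insert z I" for x y using that by auto
  fix F :: "'i set" and c :: "'i \<Rightarrow> real" assume F: "finite F" "F \<subseteq> insert z I" "sum c F = 0"
  show "quad ?N F c \<le> 0"
  proof (cases "z \<in> F")
    case False
    then have "quad ?N F c = quad N F c" by (intro quad_cong) auto
    moreover have "F \<subseteq> I" using False F by blast
    ultimately show ?thesis using N F by (simp add: neg_type_on_def)
  next
    case True
    define G where "G = F - {z}"
    have G: "F = insert z G" "finite G" "z \<notin> G" "G \<subseteq> I" using True F by (auto simp: G_def)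
    define d where "d x = (if x \<in> G then c x else 0)" for x
    have sumc: "sum c G = - c z" using F G by simp
    have dsum: "(\<Sum>x\<in>I. d x * h x) = (\<Sum>x\<in>G. c x * h x)" for h
    proof -
      have "(\<Sum>x\<in>I. d x * h x) = (\<Sum>x\<in>G. d x * h x)"
        using G I by (intro sum.mono_neutral_right) (auto simp: d_def)
      then show ?thesis by (simp add: d_def)
    qed
    have "quad N I d = quad N G d" using G I by (intro quad_mono_neutral) (auto simp: d_def)
    also have "\<dots> = quad N G c" by (intro quad_cong) (auto simp: d_def)
    finally have qd: "quad N I d = quad N G c" .
    \<comment> \<open>The weight of \<open>z\<close> is spread over \<open>I\<close> in proportion
      to \<open>l\<close>. The total stays 0, and the form of \<open>N\<close> with
      \<open>?m\<close> is the form of the extended kernel with \<open>c\<close>.\<close>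
    let ?m = "\<lambda>x. 1 * d x + c z * l x"
    have "sum ?m I = sum d I + c z" by (simp add: sum.distrib flip: sum_distrib_left) (simp add: l)
    then have "sum ?m I = 0" using dsum[of "\<lambda>_. 1"] sumc by simp
    then have le: "quad N I ?m \<le> 0" using N I by (simp add: neg_type_on_def)
    have "quad ?N F c = 2 * c z * (\<Sum>x\<in>G. c x * ?N z x) + quad ?N G c"
      using G quad_insert[of G z ?N c] by simp
    also have "quad ?N G c = quad N G c" using G by (intro quad_cong) auto
    also have "(\<Sum>x\<in>G. c x * ?N z x) = (\<Sum>x\<in>G. c x * n x)"
      using G by (intro sum.cong) auto
    also have "\<dots> = (\<Sum>x\<in>G. c x * (\<Sum>j\<in>I. l j * N x j)) - sum c G * (quad N I l / 2)"
      by (simp add: n_def algebra_simps sum_subtractf sum_distrib_left sum_distrib_right)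
    also have "2 * c z * \<dots> + quad N G c = quad N I ?m"
      using quad_lin_comb[of I N 1 d "c z" l] sym
      by (simp add: sumc qd dsum power2_eq_square algebra_simps)
    finally show ?thesis using le by simp
  qed
qed

text \<open>Points are added one at a time. By the triangle inequality of \<open>D\<close>, the
  numbers \<open>D z i\<close> are admissible squared radii in
  \<open>simplex_point_in_balls\<close>, and \<open>z\<close> is sent to the barycentre found
  there.\<close>

lemma neg_type_finite_extension:
  fixes N D :: "'i \<Rightarrow> 'i \<Rightarrow> real"
  assumes "finite B" "finite A" "neg_type_on A N" "\<And>x y. x \<in> A \<Longrightarrow> y \<in> A \<Longrightarrow> N x y \<le> D x y"
    and D: "\<And>x y. 0 \<le> D x y" "\<And>x y. D x y = D y x" "\<And>x y z. D x z \<le> D x y + D y z"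
  shows "\<exists>N'. neg_type_on (A \<union> B) N' \<and> (\<forall>x\<in>A. \<forall>y\<in>A. N' x y = N x y) \<and>
    (\<forall>x\<in>A \<union> B. \<forall>y\<in>A \<union> B. N' x y \<le> D x y)"
  using assms(1)
proof (induction B rule: finite_induct)
  case empty
  show ?case using assms by auto
next
  case (insert z B)
  then obtain N' where N': "neg_type_on (A \<union> B) N'" "\<forall>x\<in>A. \<forall>y\<in>A. N' x y = N x y"
    "\<forall>x\<in>A \<union> B. \<forall>y\<in>A \<union> B. N' x y \<le> D x y" by blast
  show ?case
  \<comment> \<open>Two degenerate situations: \<open>z\<close> is already present, or there is no
    earlier point, so that the simplex would be empty and the zero kernel serves.\<close>
  proof (cases "z \<in> A \<or> A \<union> B = {}")
    case True
    then show ?thesis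
    proof
      assume "z \<in> A"
      then have "A \<union> insert z B = A \<union> B" by blast
      then show ?thesis using N' by auto
    next
      assume "A \<union> B = {}"
      then show ?thesis using D
        by (intro exI[of _ "\<lambda>_ _. 0"]) (auto simp: neg_type_on_def quad_def)
    qed
  next
    case False
    let ?I = "A \<union> B"
    have I: "finite ?I" "?I \<noteq> {}" "z \<notin> ?I" using False insert assms by auto
    have "N' i j \<le> D z i + D z j" if "i \<in> ?I" "j \<in> ?I" for i j
      using N'(3)[rule_format, of i j] that D(3)[of i j z] D(2)[of i z] by simp
    then obtain l where l: "sum l ?I = 1"
      "\<And>i. i \<in> ?I \<Longrightarrow> (\<Sum>j\<in>?I. l j * N' i j) - quad N' ?I l / 2 \<le> D z i"
      using simplex_point_in_balls[OF I(1,2) N'(1), of "D z"] D(1) by metis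
    let ?n = "\<lambda>i. (\<Sum>j\<in>?I. l j * N' i j) - quad N' ?I l / 2"
    let ?N = "\<lambda>x y. if x = z then if y = z then 0 else ?n y else if y = z then ?n x else N' x y"
    have "neg_type_on (A \<union> insert z B) ?N"
      using neg_type_barycentric_extension[OF I(1,3) N'(1) l(1)] by simp
    moreover have "\<forall>x\<in>A. \<forall>y\<in>A. ?N x y = N x y" using N'(2) False by auto
    moreover have "\<forall>x\<in>A \<union> insert z B. \<forall>y\<in>A \<union> insert z B. ?N x y \<le> D x y"
    proof (intro ballI)
      fix x y assume xy: "x \<in> A \<union> insert z B" "y \<in> A \<union> insert z B"
      consider "x = z" "y = z" | "x = z" "y \<noteq> z" | "x \<noteq> z" "y = z" | "x \<noteq> z" "y \<noteq> z" by blast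
      then show "?N x y \<le> D x y"
      proof cases
        case 2
        then have "?n y \<le> D z y" using xy by (intro l(2)) auto
        then show ?thesis using 2 by simp
      next
        case 3
        then have "?n x \<le> D z x" using xy by (intro l(2)) auto
        then show ?thesis using 3 D(2)[of x z] by simp
      qed (use xy N'(3) D(1) in auto)
    qed
    ultimately show ?thesis by blast
  qed
qed

text \<open>Each clause involves finitely many values of \<open>N\<close>, hence is closed under
  pointwise convergence.\<close>

lemma closed_neg_type_on: "closed {N :: 'i \<Rightarrow> 'i \<Rightarrow> real. neg_type_on B N}"
proof -
  have cont: "continuous_on UNIV (\<lambda>N :: 'i \<Rightarrow> 'i \<Rightarrow> real. N x y)" for x y
    by (rule continuous_on_product_then_coordinatewise[OF continuous_on_product_coordinates])
  have imp: "closed {x. P \<longrightarrow> Q x}" if "closed {x. Q x}" for P and Q :: "('i \<Rightarrow> 'i \<Rightarrow> real) \<Rightarrow> bool"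
    using that by (cases P) auto
  show ?thesis
    unfolding neg_type_on_def quad_def Ball_def
    by (intro closed_Collect_conj closed_Collect_all imp closed_Collect_le closed_Collect_eq
        continuous_intros cont)
qed

text \<open>Minty's extension theorem for Hoelder maps of exponent 1/2 into a Hilbert space, phrased for the
  squared distances between the images.\<close>

theorem neg_type_extension:
  fixes N D :: "'i \<Rightarrow> 'i \<Rightarrow> real"
  assumes N: "neg_type_on A N" "\<And>x y. x \<in> A \<Longrightarrow> y \<in> A \<Longrightarrow> N x y \<le> D x y"
    and D: "\<And>x y. 0 \<le> D x y" "\<And>x y. D x y = D y x" "\<And>x y z. D x z \<le> D x y + D y z"
  obtains N' where "neg_type_on UNIV N'" "\<And>x y. x \<in> A \<Longrightarrow> y \<in> A \<Longrightarrow> N' x y = N x y"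
    "\<And>x y. N' x y \<le> D x y"
proof -
  define P where "P = PiE UNIV (\<lambda>x. PiE UNIV (\<lambda>y. {0..D x y}))"
  \<comment> \<open>Partial solutions on \<open>B\<close>. They shrink as \<open>B\<close> grows, so
    the intersection of finitely many of them contains the solutions on the union of the index sets,
    and the finite extension puts one of these in the compact box \<open>P\<close>.\<close>
  define S where "S B = {N'. neg_type_on B N'} \<inter> {N'. \<forall>x\<in>A \<inter> B. \<forall>y\<in>A \<inter> B. N' x y = N x y}" for B
  have cont: "continuous_on UNIV (\<lambda>N :: 'i \<Rightarrow> 'i \<Rightarrow> real. N x y)" for x y
    by (rule continuous_on_product_then_coordinatewise[OF continuous_on_product_coordinates])
  have S_mono: "S B \<subseteq> S B'" if "B' \<subseteq> B" for B B'
    using that neg_type_on_subset unfolding S_def by blast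
  have "P \<inter> \<Inter> (S ` {B. finite B}) \<noteq> {}"
  proof (rule compact_imp_fip)
    show "compact P" unfolding P_def by (intro compact_PiE_UNIV) simp
    show "closed T" if "T \<in> S ` {B. finite B}" for T
    proof -
      have "{N'. \<forall>x\<in>C. \<forall>y\<in>C. N' x y = N x y} = (\<Inter>x\<in>C. \<Inter>y\<in>C. {N'. N' x y = N x y})" for C
        by auto
      moreover have "closed (\<Inter>x\<in>C. \<Inter>y\<in>C. {N'. N' x y = N x y})" for C
        by (intro closed_INT ballI closed_Collect_eq cont continuous_intros)
      ultimately show ?thesis using that by (auto simp: S_def intro!: closed_Int closed_neg_type_on)
    qed
    fix \<F> assume "finite \<F>" "\<F> \<subseteq> S ` {B. finite B}"
    then obtain \<B> where \<B>: "\<B> \<subseteq> {B. finite B}" "finite \<B>" "\<F> = S ` \<B>"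
      using finite_subset_image by metis
    define E where "E = \<Union>\<B>"
    have fin: "finite E" using \<B> by (auto simp: E_def)
    have sub: "neg_type_on (A \<inter> E) N" by (rule neg_type_on_subset[OF N(1)]) simp
    have bound: "N x y \<le> D x y" if "x \<in> A \<inter> E" "y \<in> A \<inter> E" for x y
      using N(2) that by simp
    have AE: "A \<inter> E \<union> E = E" by blast
    have "\<exists>N'. neg_type_on (A \<inter> E \<union> E) N' \<and> (\<forall>x\<in>A \<inter> E. \<forall>y\<in>A \<inter> E. N' x y = N x y) \<and>
        (\<forall>x\<in>A \<inter> E \<union> E. \<forall>y\<in>A \<inter> E \<union> E. N' x y \<le> D x y)"
      using fin sub bound by (intro neg_type_finite_extension D) auto
    then obtain N' where N': "neg_type_on E N'" "\<forall>x\<in>A \<inter> E. \<forall>y\<in>A \<inter> E. N' x y = N x y"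
      "\<forall>x\<in>E. \<forall>y\<in>E. N' x y \<le> D x y"
      unfolding AE by blast
    \<comment> \<open>Nothing is known about \<open>N'\<close> outside \<open>E\<close>; the value 0
      there keeps \<open>M\<close> inside \<open>P\<close>.\<close>
    define M where "M x y = (if x \<in> E \<and> y \<in> E then N' x y else 0)" for x y
    have "quad M F c = quad N' F c" if "F \<subseteq> E" for F c
      using that by (intro quad_cong) (auto simp: M_def)
    then have "M \<in> S E"
      using N' unfolding S_def neg_type_on_def by (auto simp: M_def)
    moreover have "M \<in> P"
      using N' D(1) neg_type_on_nonneg[OF N'(1)] unfolding P_def by (auto simp: M_def)
    moreover have "S E \<subseteq> \<Inter>\<F>" unfolding \<B>(3) E_def by (intro INF_greatest S_mono) auto
    ultimately show "P \<inter> \<Inter>\<F> \<noteq> {}" by blast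
  qed
  then have "\<exists>M. M \<in> P \<inter> \<Inter> (S ` {B. finite B})" by (rule ex_in_conv[THEN iffD2])
  then obtain M where M0: "M \<in> P \<inter> \<Inter> (S ` {B. finite B})" by (rule exE)
  have MP: "M \<in> P" using M0 by (rule IntD1)
  have MS: "neg_type_on B M" "\<forall>x\<in>A \<inter> B. \<forall>y\<in>A \<inter> B. M x y = N x y" if "finite B" for B
    using M0 that by (auto simp: S_def)
  show thesis
  proof (rule that)
    show "neg_type_on UNIV M"
      unfolding neg_type_on_def
    proof (intro conjI allI impI ballI)
      show "M x x = 0" "M x y = M y x" for x y
        by (rule neg_type_onD[OF MS(1)[of "{x, y}"]]; simp)+
      show "quad M F c \<le> 0" if "finite F" "sum c F = 0" for F c
        using that by (intro neg_type_onD(3)[OF MS(1)[of F]]) auto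
    qed
    show "M x y = N x y" if "x \<in> A" "y \<in> A" for x y
      using MS(2)[of "{x, y}"] that by blast
    show "M x y \<le> D x y" for x y
      using PiE_mem[OF PiE_mem[OF MP[unfolded P_def]], of x y] by simp
  qed
qed

section \<open>Hilbert spaces realizing kernels of negative type\<close>

text \<open>The form may be degenerate, and its completion has to fit into
  \<open>'a \<Rightarrow> real\<close>. A vector is therefore coded by its inner products with all
  \<open>e x\<close>: the result is the reproducing kernel Hilbert space of
  \<open>B (e x) (e y)\<close>, and null vectors disappear without a quotient.\<close>

locale total_semi_inner =
  fixes B :: "'v::real_vector \<Rightarrow> 'v \<Rightarrow> real" and e :: "'a \<Rightarrow> 'v"
  assumes commute: "B u v = B v u"
    and add_left: "B (u + v) w = B u w + B v w"
    and scaleR_left: "B (a *\<^sub>R u) w = a * B u w"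
    and nonneg: "0 \<le> B u u"
    and total: "v \<in> span (range e)"
begin

lemma add_right: "B w (u + v) = B w u + B w v"
  using add_left[of u v w] commute by metis

lemma scaleR_right: "B w (a *\<^sub>R u) = a * B w u"
  using scaleR_left[of a u w] commute by metis

lemma zero_left [simp]: "B 0 w = 0"
  using scaleR_left[of 0 0 w] by simp

lemma zero_right [simp]: "B w 0 = 0"
  using scaleR_right[of w 0 0] by simp

lemma minus_left: "B (- u) w = - B u w"
  using scaleR_left[of "-1" u w] by simp

lemma diff_left: "B (u - v) w = B u w - B v w"
  using add_left[of u "- v" w] minus_left[of v w] by simp

lemma diff_right: "B w (u - v) = B w u - B w v"
  using diff_left[of u v w] commute by metis

text \<open>A null vector \<open>v\<close> is treated apart: there the form is affine in the second
  coefficient, which forces \<open>B u v = 0\<close>. Otherwise the coefficients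
  \<open>B v v\<close> and \<open>- B u v\<close> give the inequality multiplied by
  \<open>B v v\<close>.\<close>

lemma Cauchy_Schwarz: "(B u v)\<^sup>2 \<le> B u u * B v v"
proof -
  have exp: "0 \<le> a\<^sup>2 * B u u + 2 * a * b * B u v + b\<^sup>2 * B v v" for a b
    using nonneg[of "a *\<^sub>R u + b *\<^sub>R v"] commute[of v u]
    by (simp add: add_left add_right scaleR_left scaleR_right power2_eq_square algebra_simps)
  show ?thesis
  proof (cases "B v v = 0")
    case True
    have "B u v = 0"
    proof (rule ccontr)
      assume "B u v \<noteq> 0"
      then show False using exp[of 1 "- (B u u + 1) / (2 * B u v)"] True by (simp add: field_simps)
    qed
    then show ?thesis using nonneg by simp
  next
    case False
    then have pos: "0 < B v v" using nonneg[of v] by simp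
    have "0 \<le> B v v * (B u u * B v v - (B u v)\<^sup>2)"
      using exp[of "B v v" "- B u v"] by (simp add: power2_eq_square algebra_simps)
    then show ?thesis using pos by (simp add: zero_le_mult_iff)
  qed
qed

definition nrm :: "'v \<Rightarrow> real" where "nrm u = sqrt (B u u)"

lemma nrm_nonneg [simp]: "0 \<le> nrm u"
  by (simp add: nrm_def nonneg)

lemma nrm_power2: "(nrm u)\<^sup>2 = B u u"
  by (simp add: nrm_def nonneg)

lemma abs_le_nrm: "\<bar>B u v\<bar> \<le> nrm u * nrm v"
  unfolding nrm_def real_sqrt_mult[symmetric]
  using Cauchy_Schwarz by (intro real_le_rsqrt) simp

lemma nrm_triangle: "nrm (u + v) \<le> nrm u + nrm v"
proof (rule power2_le_imp_le)
  have "B u v \<le> nrm u * nrm v" using abs_le_nrm[of u v] by simp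
  then show "(nrm (u + v))\<^sup>2 \<le> (nrm u + nrm v)\<^sup>2"
    using commute[of v u] by (simp add: nrm_power2 power2_sum add_left add_right)
qed simp

definition Cauchy_seq :: "(nat \<Rightarrow> 'v) \<Rightarrow> bool" where
  "Cauchy_seq s \<longleftrightarrow> (\<forall>\<epsilon>>0. \<exists>M. \<forall>m\<ge>M. \<forall>n\<ge>M. nrm (s m - s n) < \<epsilon>)"

definition represents :: "(nat \<Rightarrow> 'v) \<Rightarrow> ('a \<Rightarrow> real) \<Rightarrow> bool" where
  "represents s h \<longleftrightarrow> Cauchy_seq s \<and> (\<forall>x. (\<lambda>n. B (s n) (e x)) \<longlonglongrightarrow> h x)"

definition completion :: "('a \<Rightarrow> real) set" where
  "completion = {h. \<exists>s. represents s h}"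

text \<open>Representing sequences are picked by \<open>SOME\<close>; that the value does not depend
  on them is \<open>inner_completion_tendsto\<close>.\<close>

definition inner_completion :: "('a \<Rightarrow> real) \<Rightarrow> ('a \<Rightarrow> real) \<Rightarrow> real" where
  "inner_completion h g =
    lim (\<lambda>n. B ((SOME s. represents s h) n) ((SOME t. represents t g) n))"

definition embed :: "'v \<Rightarrow> 'a \<Rightarrow> real" where
  "embed v x = B v (e x)"

section \<open>Cauchy sequences and their weak limits\<close>

lemma Cauchy_seq_const: "Cauchy_seq (\<lambda>_. v)"
  by (simp add: Cauchy_seq_def nrm_def)

lemma Cauchy_seq_add:
  assumes "Cauchy_seq s" "Cauchy_seq t"
  shows "Cauchy_seq (\<lambda>n. s n + t n)"
  unfolding Cauchy_seq_def
proof (intro allI impI)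
  fix \<epsilon> :: real assume "0 < \<epsilon>"
  then obtain M M' where "\<forall>m\<ge>M. \<forall>n\<ge>M. nrm (s m - s n) < \<epsilon> / 2" "\<forall>m\<ge>M'. \<forall>n\<ge>M'. nrm (t m - t n) < \<epsilon> / 2"
    using assms unfolding Cauchy_seq_def by (meson half_gt_zero)
  then have "nrm (s m + t m - (s n + t n)) < \<epsilon>" if "m \<ge> max M M'" "n \<ge> max M M'" for m n
    using nrm_triangle[of "s m - s n" "t m - t n"] that by (fastforce simp: add_diff_add)
  then show "\<exists>M. \<forall>m\<ge>M. \<forall>n\<ge>M. nrm (s m + t m - (s n + t n)) < \<epsilon>" by blast
qed

lemma nrm_scaleR: "nrm (a *\<^sub>R u) = \<bar>a\<bar> * nrm u"
  by (simp add: nrm_def scaleR_left scaleR_right real_sqrt_mult)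

lemma Cauchy_seq_scaleR:
  assumes "Cauchy_seq s"
  shows "Cauchy_seq (\<lambda>n. a *\<^sub>R s n)"
  unfolding Cauchy_seq_def
proof (intro allI impI)
  fix \<epsilon> :: real assume \<epsilon>: "0 < \<epsilon>"
  then have "0 < \<epsilon> / (\<bar>a\<bar> + 1)" by simp
  then obtain M where M: "\<forall>m\<ge>M. \<forall>n\<ge>M. nrm (s m - s n) < \<epsilon> / (\<bar>a\<bar> + 1)"
    using assms unfolding Cauchy_seq_def by blast
  have "nrm (a *\<^sub>R s m - a *\<^sub>R s n) < \<epsilon>" if "m \<ge> M" "n \<ge> M" for m n
  proof -
    have "nrm (a *\<^sub>R s m - a *\<^sub>R s n) = \<bar>a\<bar> * nrm (s m - s n)"
      by (simp add: nrm_scaleR flip: scaleR_diff_right)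
    also have "\<dots> \<le> (\<bar>a\<bar> + 1) * nrm (s m - s n)" by (intro mult_right_mono) auto
    also have "\<dots> < \<epsilon>"
      using M that by (simp add: pos_less_divide_eq mult.commute)
    finally show ?thesis .
  qed
  then show "\<exists>M. \<forall>m\<ge>M. \<forall>n\<ge>M. nrm (a *\<^sub>R s m - a *\<^sub>R s n) < \<epsilon>" by blast
qed

lemma Cauchy_seq_bounded:
  assumes "Cauchy_seq s"
  obtains C where "0 < C" "\<And>n. nrm (s n) \<le> C"
proof -
  obtain M where M: "\<forall>m\<ge>M. \<forall>n\<ge>M. nrm (s m - s n) < 1"
    using assms unfolding Cauchy_seq_def by (meson zero_less_one)
  let ?C = "(\<Sum>n<M. nrm (s n)) + nrm (s M) + 1"
  have "nrm (s n) \<le> ?C" for n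
  proof (cases "n < M")
    case True
    then have "nrm (s n) \<le> (\<Sum>n<M. nrm (s n))" by (intro member_le_sum) auto
    then show ?thesis using nrm_nonneg[of "s M"] by linarith
  next
    case False
    then have "nrm (s n - s M) < 1" using M by simp
    moreover have "0 \<le> (\<Sum>n<M. nrm (s n))" by (intro sum_nonneg) auto
    ultimately show ?thesis using nrm_triangle[of "s n - s M" "s M"] by simp
  qed
  moreover have "0 < ?C" by (intro add_nonneg_pos add_nonneg_nonneg sum_nonneg) auto
  ultimately show thesis by (rule that[rotated])
qed

lemma convergent_inner:
  assumes "Cauchy_seq s" "Cauchy_seq t"
  shows "convergent (\<lambda>n. B (s n) (t n))"
proof (rule real_Cauchy_convergent, rule CauchyI)
  obtain C where C: "0 < C" "\<And>n. nrm (s n) \<le> C" using Cauchy_seq_bounded assms by metis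
  obtain C' where C': "0 < C'" "\<And>n. nrm (t n) \<le> C'" using Cauchy_seq_bounded assms by metis
  fix \<epsilon> :: real assume "0 < \<epsilon>"
  then have "0 < \<epsilon> / (C + C')" using C C' by simp
  then obtain M M' where M: "\<forall>m\<ge>M. \<forall>n\<ge>M. nrm (s m - s n) < \<epsilon> / (C + C')"
    "\<forall>m\<ge>M'. \<forall>n\<ge>M'. nrm (t m - t n) < \<epsilon> / (C + C')"
    using assms unfolding Cauchy_seq_def by meson
  have "norm (B (s m) (t m) - B (s n) (t n)) < \<epsilon>" if "m \<ge> max M M'" "n \<ge> max M M'" for m n
  proof -
    have "B (s m) (t m) - B (s n) (t n) = B (s m - s n) (t m) + B (s n) (t m - t n)"
      by (simp add: diff_left diff_right)
    also have "\<bar>\<dots>\<bar> \<le> nrm (s m - s n) * nrm (t m) + nrm (s n) * nrm (t m - t n)"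
      using abs_le_nrm by (meson abs_triangle_ineq add_mono order_trans)
    also have "\<dots> \<le> nrm (s m - s n) * C' + C * nrm (t m - t n)"
      using C C' by (intro add_mono mult_left_mono mult_right_mono) auto
    also have "\<dots> < \<epsilon> / (C + C') * C' + C * (\<epsilon> / (C + C'))"
      using M that C(1) C'(1) by (intro add_strict_mono mult_strict_left_mono mult_strict_right_mono) auto
    also have "\<dots> = \<epsilon> / (C + C') * (C + C')" by (simp only: ring_distribs mult.commute add.commute)
    also have "\<dots> = \<epsilon>" using C(1) C'(1) by simp
    finally show ?thesis by simp
  qed
  then show "\<exists>M. \<forall>m\<ge>M. \<forall>n\<ge>M. norm (B (s m) (t m) - B (s n) (t n)) < \<epsilon>" by blast
qed

text \<open>This makes the coding by functions faithful. Weak convergence extends to the span; in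
  \<open>B (s n) (s n - s M) + B (s n) (s M)\<close> the first term is small by the Cauchy property,
  the second for fixed \<open>M\<close> by weak convergence.\<close>

lemma Cauchy_seq_weakly_null:
  assumes s: "Cauchy_seq s" and null: "\<And>x. (\<lambda>n. B (s n) (e x)) \<longlonglongrightarrow> 0"
  shows "(\<lambda>n. nrm (s n)) \<longlonglongrightarrow> 0"
proof -
  have weak: "(\<lambda>n. B (s n) v) \<longlonglongrightarrow> 0" for v
    using total[of v]
  proof (induction v rule: span_induct_alt)
    case (step c x y)
    then obtain a where "x = e a" by blast
    then have "(\<lambda>n. c * B (s n) x + B (s n) y) \<longlonglongrightarrow> c * 0 + 0"
      using null step by (intro tendsto_intros) auto
    then show ?case by (simp add: add_right scaleR_right)
  qed simp
  obtain C where C: "0 < C" "\<And>n. nrm (s n) \<le> C" using Cauchy_seq_bounded[OF s] by metis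
  have "(\<lambda>n. B (s n) (s n)) \<longlonglongrightarrow> 0"
  proof (rule LIMSEQ_I)
    fix \<epsilon> :: real assume \<epsilon>: "0 < \<epsilon>"
    then have "0 < \<epsilon> / (2 * C)" using C by simp
    then obtain M where M: "\<forall>m\<ge>M. \<forall>n\<ge>M. nrm (s m - s n) < \<epsilon> / (2 * C)"
      using s unfolding Cauchy_seq_def by blast
    obtain M' where M': "\<forall>n\<ge>M'. norm (B (s n) (s M) - 0) < \<epsilon> / 2"
      using LIMSEQ_D[OF weak[of "s M"], of "\<epsilon> / 2"] \<epsilon> by auto
    have "norm (B (s n) (s n) - 0) < \<epsilon>" if n: "n \<ge> max M M'" for n
    proof -
      have "\<bar>B (s n) (s n - s M)\<bar> \<le> C * (\<epsilon> / (2 * C))"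
        using C M n by (intro order_trans[OF abs_le_nrm] mult_mono) (auto intro: less_imp_le)
      also have "\<dots> = \<epsilon> / 2" using C by simp
      finally have "\<bar>B (s n) (s n - s M)\<bar> \<le> \<epsilon> / 2" .
      moreover have "\<bar>B (s n) (s M)\<bar> < \<epsilon> / 2" using M' n by simp
      moreover have "B (s n) (s n) = B (s n) (s n - s M) + B (s n) (s M)" by (simp add: diff_right)
      ultimately show ?thesis
        using abs_triangle_ineq[of "B (s n) (s n - s M)" "B (s n) (s M)"] by simp
    qed
    then show "\<exists>M. \<forall>n\<ge>M. norm (B (s n) (s n) - 0) < \<epsilon>" by blast
  qed
  then show ?thesis unfolding nrm_def using tendsto_real_sqrt by fastforce
qed

lemma represents_add:
  "represents s h \<Longrightarrow> represents t g \<Longrightarrow> represents (\<lambda>n. s n + t n) (\<lambda>x. h x + g x)"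
  by (simp add: represents_def Cauchy_seq_add add_left tendsto_add)

lemma represents_scaleR: "represents s h \<Longrightarrow> represents (\<lambda>n. a *\<^sub>R s n) (\<lambda>x. a * h x)"
  by (simp add: represents_def Cauchy_seq_scaleR scaleR_left tendsto_mult_left)

lemma represents_diff:
  "represents s h \<Longrightarrow> represents t g \<Longrightarrow> represents (\<lambda>n. s n - t n) (\<lambda>x. h x - g x)"
  using represents_add[OF _ represents_scaleR[of t g "-1"]] by simp

lemma represents_embed: "represents (\<lambda>_. v) (embed v)"
  by (simp add: represents_def Cauchy_seq_const embed_def)

lemma represents_unique:
  assumes "represents s h" "represents t h"
  shows "(\<lambda>n. nrm (s n - t n)) \<longlonglongrightarrow> 0"
  using represents_diff[OF assms] by (intro Cauchy_seq_weakly_null) (simp_all add: represents_def)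

text \<open>Two sequences representing the same function differ by a norm null sequence, and the
  remaining factors are bounded.\<close>

lemma inner_completion_tendsto:
  assumes s: "represents s h" and t: "represents t g"
  shows "(\<lambda>n. B (s n) (t n)) \<longlonglongrightarrow> inner_completion h g"
proof -
  define s' where "s' = (SOME s. represents s h)"
  define t' where "t' = (SOME t. represents t g)"
  have s': "represents s' h" unfolding s'_def using s by (rule someI[where P = "\<lambda>s. represents s h"])
  have t': "represents t' g" unfolding t'_def using t by (rule someI[where P = "\<lambda>s. represents s g"])
  have lim: "(\<lambda>n. B (s' n) (t' n)) \<longlonglongrightarrow> inner_completion h g"
    unfolding inner_completion_def s'_def[symmetric] t'_def[symmetric]
    using s' t' by (intro convergent_LIMSEQ_iff[THEN iffD1] convergent_inner) (auto simp: represents_def)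
  obtain C where C: "\<And>n. nrm (t n) \<le> C" using Cauchy_seq_bounded t unfolding represents_def by metis
  obtain C' where C': "\<And>n. nrm (s' n) \<le> C'" using Cauchy_seq_bounded s' unfolding represents_def by metis
  have "(\<lambda>n. nrm (s n - s' n) * C + C' * nrm (t n - t' n)) \<longlonglongrightarrow> 0 * C + C' * 0"
    by (intro tendsto_intros represents_unique[OF s s'] represents_unique[OF t t'])
  then have null: "(\<lambda>n. nrm (s n - s' n) * C + C' * nrm (t n - t' n)) \<longlonglongrightarrow> 0" by simp
  have "norm (B (s n) (t n) - B (s' n) (t' n)) \<le> nrm (s n - s' n) * C + C' * nrm (t n - t' n)" for n
  proof -
    have "B (s n) (t n) - B (s' n) (t' n) = B (s n - s' n) (t n) + B (s' n) (t n - t' n)"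
      by (simp add: diff_left diff_right)
    also have "\<bar>\<dots>\<bar> \<le> nrm (s n - s' n) * nrm (t n) + nrm (s' n) * nrm (t n - t' n)"
      using abs_le_nrm by (meson abs_triangle_ineq add_mono order_trans)
    also have "\<dots> \<le> nrm (s n - s' n) * C + C' * nrm (t n - t' n)"
      using C C' by (intro add_mono mult_left_mono mult_right_mono) auto
    finally show ?thesis by simp
  qed
  then have "(\<lambda>n. B (s n) (t n) - B (s' n) (t' n)) \<longlonglongrightarrow> 0"
    by (intro Lim_null_comparison[OF _ null]) simp
  from tendsto_add[OF this lim] show ?thesis by simp
qed

lemma inner_completion_eqI:
  "represents s h \<Longrightarrow> represents t g \<Longrightarrow> (\<lambda>n. B (s n) (t n)) \<longlonglongrightarrow> L \<Longrightarrow> inner_completion h g = L"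
  using inner_completion_tendsto LIMSEQ_unique by blast

section \<open>The inner product on the completion\<close>

lemma completion_add: "h \<in> completion \<Longrightarrow> g \<in> completion \<Longrightarrow> (\<lambda>x. h x + g x) \<in> completion"
  unfolding completion_def using represents_add by blast

lemma completion_scale: "h \<in> completion \<Longrightarrow> (\<lambda>x. a * h x) \<in> completion"
  unfolding completion_def using represents_scaleR by blast

lemma completion_embed: "embed v \<in> completion"
  unfolding completion_def using represents_embed by blast

lemma completion_zero: "(\<lambda>_. 0) \<in> completion"
  using completion_embed[of 0] by (simp add: embed_def[abs_def])

lemma inner_completion_embed: "inner_completion (embed u) (embed v) = B u v"
  by (rule inner_completion_eqI[OF represents_embed represents_embed]) simp

lemma inner_completion_commute:
  assumes "h \<in> completion" "g \<in> completion"
  shows "inner_completion h g = inner_completion g h"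
proof -
  obtain s t where st: "represents s h" "represents t g" using assms unfolding completion_def by blast
  show ?thesis
    using inner_completion_tendsto[OF st(2,1)] by (intro inner_completion_eqI[OF st]) (simp add: commute)
qed

lemma inner_completion_add_left:
  assumes "h \<in> completion" "g \<in> completion" "k \<in> completion"
  shows "inner_completion (\<lambda>x. h x + g x) k = inner_completion h k + inner_completion g k"
proof -
  obtain s t u where st: "represents s h" "represents t g" "represents u k"
    using assms unfolding completion_def by blast
  show ?thesis
    using tendsto_add[OF inner_completion_tendsto[OF st(1,3)] inner_completion_tendsto[OF st(2,3)]]
    by (intro inner_completion_eqI[OF represents_add[OF st(1,2)] st(3)]) (simp add: add_left)
qed

lemma inner_completion_scale_left:
  assumes "h \<in> completion" "g \<in> completion"
  shows "inner_completion (\<lambda>x. a * h x) g = a * inner_completion h g"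
proof -
  obtain s t where st: "represents s h" "represents t g" using assms unfolding completion_def by blast
  show ?thesis
    using tendsto_mult_left[OF inner_completion_tendsto[OF st]]
    by (intro inner_completion_eqI[OF represents_scaleR[OF st(1)] st(2)]) (simp add: scaleR_left)
qed

lemma inner_completion_nonneg:
  assumes "h \<in> completion"
  shows "0 \<le> inner_completion h h"
proof -
  obtain s where s: "represents s h" using assms unfolding completion_def by blast
  show ?thesis
    by (rule LIMSEQ_le_const[OF inner_completion_tendsto[OF s s]]) (auto simp: nonneg)
qed

text \<open>A representing sequence is norm null, so by Cauchy-Schwarz all its inner products with
  \<open>e x\<close> tend to 0; their limits are the values of \<open>h\<close>.\<close>

lemma inner_completion_definite:
  assumes "h \<in> completion" "inner_completion h h = 0"
  shows "h = (\<lambda>_. 0)"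
proof
  fix x
  obtain s where s: "represents s h" using assms unfolding completion_def by blast
  have "(\<lambda>n. nrm (s n)) \<longlonglongrightarrow> 0"
    using tendsto_real_sqrt[OF inner_completion_tendsto[OF s s]] assms by (simp add: nrm_def)
  then have "(\<lambda>n. nrm (s n) * nrm (e x)) \<longlonglongrightarrow> 0" by (rule tendsto_mult_left_zero)
  then have "(\<lambda>n. B (s n) (e x)) \<longlonglongrightarrow> 0"
    by (rule Lim_null_comparison[rotated]) (simp add: abs_le_nrm)
  then show "h x = 0" using s LIMSEQ_unique unfolding represents_def by blast
qed

lemma inner_completion_diff_le:
  assumes s: "represents s h" and M: "\<And>n. n \<ge> M \<Longrightarrow> nrm (s n - v) \<le> c"
  shows "sqrt (inner_completion (\<lambda>x. h x - embed v x) (\<lambda>x. h x - embed v x)) \<le> c"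
proof -
  have rep: "represents (\<lambda>n. s n - v) (\<lambda>x. h x - embed v x)"
    using represents_diff[OF s represents_embed] .
  have "(\<lambda>n. nrm (s n - v)) \<longlonglongrightarrow> sqrt (inner_completion (\<lambda>x. h x - embed v x) (\<lambda>x. h x - embed v x))"
    unfolding nrm_def by (intro tendsto_real_sqrt inner_completion_tendsto rep)
  then show ?thesis by (rule LIMSEQ_le_const2) (use M in blast)
qed

lemma embed_dense:
  assumes "h \<in> completion" "0 < c"
  obtains v where "sqrt (inner_completion (\<lambda>x. h x - embed v x) (\<lambda>x. h x - embed v x)) \<le> c"
proof -
  obtain s where s: "represents s h" using assms unfolding completion_def by blast
  then obtain M where "\<forall>m\<ge>M. \<forall>n\<ge>M. nrm (s m - s n) < c"
    using assms(2) unfolding represents_def Cauchy_seq_def by blast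
  then show thesis
    by (intro that[of "s M"] inner_completion_diff_le[OF s, of M]) (simp add: less_imp_le)
qed

text \<open>The vectors are tagged with \<open>Inr\<close> in order to have the type required by
  \<^const>\<open>coarsely_embeds_Hilbert\<close>.\<close>

definition completion_module :: "(real, 'u + ('a \<Rightarrow> real)) module" where
  "completion_module = \<lparr>carrier = Inr ` completion, monoid.mult = undefined, one = undefined,
     zero = Inr (\<lambda>_. 0), add = (\<lambda>a b. Inr (\<lambda>x. projr a x + projr b x)),
     smult = (\<lambda>c a. Inr (\<lambda>x. c * projr a x))\<rparr>"

definition completion_ip :: "'u + ('a \<Rightarrow> real) \<Rightarrow> 'u + ('a \<Rightarrow> real) \<Rightarrow> real" where
  "completion_ip a b = inner_completion (projr a) (projr b)"

section \<open>The completion as a Hilbert space on a carrier set\<close>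

lemma cring_real_ring: "cring real_ring"
  by (rule cringI, rule abelian_groupI, unfold_locales)
    (auto simp: real_ring_def algebra_simps intro: exI[of _ "- _"])

lemma abelian_group_completion: "abelian_group (completion_module :: (real, 'u + ('a \<Rightarrow> real)) module)"
proof (rule abelian_groupI)
  fix a :: "'u + ('a \<Rightarrow> real)" assume "a \<in> carrier completion_module"
  then obtain h where h: "a = Inr h" "h \<in> completion" by (auto simp: completion_module_def)
  show "\<exists>b\<in>carrier completion_module. b \<oplus>\<^bsub>completion_module\<^esub> a = \<zero>\<^bsub>completion_module\<^esub>"
    using completion_scale[OF h(2), of "-1"] h(1)
    by (intro bexI[of _ "Inr (\<lambda>x. -1 * h x)"]) (auto simp: completion_module_def)
qed (auto simp: completion_module_def completion_add completion_zero algebra_simps)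

lemma module_completion: "module real_ring (completion_module :: (real, 'u + ('a \<Rightarrow> real)) module)"
  by (rule moduleI[OF cring_real_ring abelian_group_completion])
    (auto simp: completion_module_def real_ring_def completion_scale algebra_simps)

lemma inner_product_space_completion:
  "real_inner_product_space (completion_module :: (real, 'u + ('a \<Rightarrow> real)) module) completion_ip"
  by (intro real_inner_product_space.intro module_completion real_inner_product_space_axioms.intro)
    (auto simp: completion_module_def completion_ip_def inner_completion_commute inner_completion_nonneg
      inner_completion_add_left inner_completion_scale_left dest: inner_completion_definite)

lemma ip_dist_completion:
  assumes "h \<in> completion" "g \<in> completion"
  shows "ip_dist completion_module completion_ip (Inr h :: 'u + _) (Inr g)
    = sqrt (inner_completion (\<lambda>x. h x - g x) (\<lambda>x. h x - g x))"
proof -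
  interpret C: real_inner_product_space "completion_module :: (real, 'u + ('a \<Rightarrow> real)) module" completion_ip
    by (rule inner_product_space_completion)
  have "\<ominus>\<^bsub>completion_module\<^esub> (Inr g :: 'u + _) = Inr (\<lambda>x. -1 * g x)"
    using completion_scale[OF assms(2), of "-1"] assms(2)
    by (intro C.M.minus_equality) (auto simp: completion_module_def)
  then have "(Inr h :: 'u + _) \<ominus>\<^bsub>completion_module\<^esub> Inr g = Inr (\<lambda>x. h x - g x)"
    by (simp add: a_minus_def completion_module_def)
  then show ?thesis using assms by (simp add: ip_dist_def completion_module_def completion_ip_def)
qed

lemma ip_dist_embed:
  "ip_dist completion_module completion_ip (Inr (embed u) :: 'u + _) (Inr (embed v)) = nrm (u - v)"
proof -
  have "(\<lambda>x. embed u x - embed v x) = embed (u - v)"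
    by (simp add: embed_def diff_left fun_eq_iff)
  then show ?thesis
    by (simp add: ip_dist_completion completion_embed inner_completion_embed nrm_def)
qed

text \<open>Each \<open>\<sigma> k\<close> is approximated by an embedded vector \<open>v k\<close>
  within \<open>1 / (k + 1)\<close>. The sequence \<open>v\<close> is then Cauchy, hence represents
  an element \<open>h\<close>, which is the limit of \<open>\<sigma>\<close>.\<close>

lemma Hilbert_space_completion:
  "real_Hilbert_space (completion_module :: (real, 'u + ('a \<Rightarrow> real)) module) completion_ip"
proof -
  let ?V = "completion_module :: (real, 'u + ('a \<Rightarrow> real)) module"
  interpret C: real_inner_product_space ?V completion_ip
    by (rule inner_product_space_completion)
  let ?d = "ip_dist ?V completion_ip"
  interpret D: Metric_space "carrier ?V" ?d
    by (rule C.Metric_space_ip_dist)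
  have emb: "Inr (embed v) \<in> carrier ?V" for v by (simp add: completion_module_def completion_embed)
  have "D.mcomplete"
    unfolding D.mcomplete_def
  proof (intro allI impI)
    fix \<sigma> assume \<sigma>: "D.MCauchy \<sigma>"
    have \<sigma>V: "\<sigma> k \<in> carrier ?V" for k using \<sigma> by (auto simp: D.MCauchy_def)
    have "\<exists>v. ?d (\<sigma> k) (Inr (embed v)) \<le> 1 / real (Suc k)" for k
    proof -
      obtain h where h: "\<sigma> k = Inr h" "h \<in> completion" using \<sigma>V[of k] by (auto simp: completion_module_def)
      have "0 < 1 / real (Suc k)" by simp
      from embed_dense[OF h(2) this] obtain v
        where "sqrt (inner_completion (\<lambda>x. h x - embed v x) (\<lambda>x. h x - embed v x)) \<le> 1 / real (Suc k)" .
      then have "?d (\<sigma> k) (Inr (embed v)) \<le> 1 / real (Suc k)"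
        unfolding h(1) ip_dist_completion[OF h(2) completion_embed] .
      then show ?thesis ..
    qed
    then obtain v where v: "\<And>k. ?d (\<sigma> k) (Inr (embed (v k))) \<le> 1 / real (Suc k)" by metis
    have "Cauchy_seq v"
      unfolding Cauchy_seq_def
    proof (intro allI impI)
      fix \<epsilon> :: real assume \<epsilon>: "0 < \<epsilon>"
      then obtain M where M: "\<And>m n. M \<le> m \<Longrightarrow> M \<le> n \<Longrightarrow> ?d (\<sigma> m) (\<sigma> n) < \<epsilon> / 3"
        using \<sigma> unfolding D.MCauchy_def by (meson divide_pos_pos zero_less_numeral)
      obtain K where K: "inverse (real (Suc K)) < \<epsilon> / 3" using reals_Archimedean[of "\<epsilon> / 3"] \<epsilon> by auto
      have small: "?d (\<sigma> k) (Inr (embed (v k))) < \<epsilon> / 3" if "k \<ge> K" for k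
      proof -
        have "1 / real (Suc k) \<le> inverse (real (Suc K))" using that by (simp add: field_simps)
        then show ?thesis using v[of k] K by linarith
      qed
      have "nrm (v m - v n) < \<epsilon>" if mn: "m \<ge> max M K" "n \<ge> max M K" for m n
      proof -
        have "nrm (v m - v n) = ?d (Inr (embed (v m))) (Inr (embed (v n)))" by (simp add: ip_dist_embed)
        also have "\<dots> \<le> ?d (Inr (embed (v m))) (\<sigma> m) + ?d (\<sigma> m) (Inr (embed (v n)))"
          by (intro D.triangle emb \<sigma>V)
        also have "\<dots> \<le> ?d (\<sigma> m) (Inr (embed (v m))) + (?d (\<sigma> m) (\<sigma> n) + ?d (\<sigma> n) (Inr (embed (v n))))"
          using D.triangle[OF \<sigma>V \<sigma>V emb] D.commute by (simp add: add_mono)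
        also have "\<dots> < \<epsilon>"
          using small[of m] small[of n] M[of m n] mn by simp
        finally show ?thesis .
      qed
      then show "\<exists>M. \<forall>m\<ge>M. \<forall>n\<ge>M. nrm (v m - v n) < \<epsilon>" by blast
    qed
    define h where "h x = lim (\<lambda>n. B (v n) (e x))" for x
    have rep: "represents v h"
      unfolding represents_def h_def
      using \<open>Cauchy_seq v\<close> convergent_inner[OF _ Cauchy_seq_const] by (simp add: convergent_LIMSEQ_iff)
    then have hH: "h \<in> completion" unfolding completion_def by blast
    have "limitin D.mtopology \<sigma> (Inr h) sequentially"
      unfolding D.limit_metric_sequentially
    proof (intro conjI allI impI)
      show hV: "Inr h \<in> carrier ?V" using hH by (simp add: completion_module_def)
      fix \<epsilon> :: real assume \<epsilon>: "0 < \<epsilon>"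
      obtain M where M: "\<forall>m\<ge>M. \<forall>n\<ge>M. nrm (v m - v n) < \<epsilon> / 2"
        using \<open>Cauchy_seq v\<close> \<epsilon> unfolding Cauchy_seq_def by (meson half_gt_zero)
      obtain K where K: "inverse (real (Suc K)) < \<epsilon> / 2" using reals_Archimedean[of "\<epsilon> / 2"] \<epsilon> by auto
      have "\<sigma> n \<in> carrier ?V \<and> ?d (\<sigma> n) (Inr h) < \<epsilon>" if n: "n \<ge> max M K" for n
      proof -
        have "?d (Inr h) (Inr (embed (v n))) \<le> \<epsilon> / 2"
          unfolding ip_dist_completion[OF hH completion_embed]
          by (rule inner_completion_diff_le[OF rep, of M]) (use M n in \<open>auto intro: less_imp_le\<close>)
        moreover have "1 / real (Suc n) \<le> inverse (real (Suc K))" using n by (simp add: field_simps)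
        ultimately show ?thesis
          using D.triangle[OF \<sigma>V[of n] emb[of "v n"] hV] v[of n] K \<sigma>V D.commute[of "Inr h" "Inr (embed (v n))"] by auto
      qed
      then show "\<exists>N. \<forall>n\<ge>N. \<sigma> n \<in> carrier ?V \<and> ?d (\<sigma> n) (Inr h) < \<epsilon>" by blast
    qed
    then show "\<exists>x. limitin D.mtopology \<sigma> x sequentially" by blast
  qed
  then show ?thesis by unfold_locales
qed

end

lemma lookup_scaleR: "Poly_Mapping.lookup (a *\<^sub>R c) x = a *\<^sub>R Poly_Mapping.lookup c x"
proof -
  have "finite {x. a *\<^sub>R Poly_Mapping.lookup c x \<noteq> 0}"
    by (rule finite_subset[OF _ finite_keys[of c]]) (auto simp: in_keys_iff)
  then show ?thesis by (simp add: scaleR_poly_mapping_def)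
qed

text \<open>The kernel based at \<open>undefined\<close> gives a semi-inner product on the free
  vector space over \<open>'a\<close>, realised by finitely supported functions, and its completion
  is the target. The factor 1/2 makes the squared distance of basis vectors exactly
  \<open>N x y\<close>.\<close>

lemma neg_type_realization:
  fixes N :: "'a \<Rightarrow> 'a \<Rightarrow> real"
  assumes N: "neg_type_on UNIV N"
  obtains V :: "(real, 'u + ('a \<Rightarrow> real)) module" and ip f
  where "real_Hilbert_space V ip" "\<And>x. f x \<in> carrier V" "\<And>x y. ip_dist V ip (f x) (f y) = sqrt (N x y)"
proof -
  define K where "K x y = 1 / 2 * (N x undefined + N y undefined - N x y)" for x y
  have K: "pos_def_on UNIV K"
    using pos_def_of_neg_type[OF N, of undefined] unfolding pos_def_on_def K_def quad_scale by simp
  let ?l = "Poly_Mapping.lookup :: ('a \<Rightarrow>\<^sub>0 real) \<Rightarrow> _"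
  define B where "B c d = (\<Sum>x\<in>Poly_Mapping.keys c. \<Sum>y\<in>Poly_Mapping.keys d. ?l c x * ?l d y * K x y)" for c d
  let ?e = "\<lambda>x. Poly_Mapping.single x (1 :: real)"
  have B_eq: "B c d = (\<Sum>x\<in>F. \<Sum>y\<in>G. ?l c x * ?l d y * K x y)"
    if "finite F" "Poly_Mapping.keys c \<subseteq> F" "finite G" "Poly_Mapping.keys d \<subseteq> G" for c d F G
  proof -
    have "(\<Sum>x\<in>F. \<Sum>y\<in>G. ?l c x * ?l d y * K x y) = (\<Sum>x\<in>Poly_Mapping.keys c. \<Sum>y\<in>G. ?l c x * ?l d y * K x y)"
      using that by (intro sum.mono_neutral_right) (auto simp: in_keys_iff intro!: sum.neutral)
    also have "\<dots> = B c d"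
      unfolding B_def using that
      by (intro sum.cong refl sum.mono_neutral_right) (auto simp: in_keys_iff)
    finally show ?thesis ..
  qed
  interpret T: total_semi_inner B ?e
  proof
    show "B u v = B v u" for u v
    proof -
      have "K x y = K y x" for x y using K by (simp add: pos_def_on_def)
      then show ?thesis unfolding B_def by (subst sum.swap) (simp add: mult_ac)
    qed
    show "B (u + v) w = B u w + B v w" for u v w
    proof -
      let ?F = "Poly_Mapping.keys u \<union> Poly_Mapping.keys v"
      have "Poly_Mapping.keys (u + v) \<subseteq> ?F" by (rule keys_add)
      then have "B (u + v) w = (\<Sum>x\<in>?F. \<Sum>y\<in>Poly_Mapping.keys w. ?l (u + v) x * ?l w y * K x y)"
        by (intro B_eq) auto
      moreover have "B u w = (\<Sum>x\<in>?F. \<Sum>y\<in>Poly_Mapping.keys w. ?l u x * ?l w y * K x y)" by (intro B_eq) auto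
      moreover have "B v w = (\<Sum>x\<in>?F. \<Sum>y\<in>Poly_Mapping.keys w. ?l v x * ?l w y * K x y)" by (intro B_eq) auto
      ultimately show ?thesis by (simp add: lookup_add sum.distrib algebra_simps)
    qed
    show "B (a *\<^sub>R u) w = a * B u w" for a u w
    proof -
      have "Poly_Mapping.keys (a *\<^sub>R u) \<subseteq> Poly_Mapping.keys u" by (auto simp: in_keys_iff lookup_scaleR)
      then have "B (a *\<^sub>R u) w = (\<Sum>x\<in>Poly_Mapping.keys u. \<Sum>y\<in>Poly_Mapping.keys w. ?l (a *\<^sub>R u) x * ?l w y * K x y)"
        by (intro B_eq) auto
      then show ?thesis by (simp add: B_def lookup_scaleR sum_distrib_left mult_ac)
    qed
    show "0 \<le> B u u" for u
      using K by (simp add: B_def pos_def_on_def flip: quad_def)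
    show "v \<in> span (range ?e)" for v :: "'a \<Rightarrow>\<^sub>0 real"
    proof -
      have "v = (\<Sum>x\<in>Poly_Mapping.keys v. ?l v x *\<^sub>R ?e x)"
        by (rule poly_mapping_eqI)
          (simp add: lookup_sum lookup_scaleR lookup_single when_def sum.delta in_keys_iff
            if_distrib[of "\<lambda>x. _ * x"] cong: if_cong)
      also have "\<dots> \<in> span (range ?e)"
        by (intro span_sum span_scale span_base) auto
      finally show ?thesis .
    qed
  qed
  have BK: "B (?e x) (?e y) = K x y" for x y by (simp add: B_def)
  have "N x x = 0" "N x y = N y x" for x y using N by (simp_all add: neg_type_on_def)
  then have "B (?e x - ?e y) (?e x - ?e y) = N x y" for x y
    unfolding T.diff_left T.diff_right BK K_def by (simp add: field_simps)
  then have "T.nrm (?e x - ?e y) = sqrt (N x y)" for x y by (simp add: T.nrm_def)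
  then have dist: "ip_dist T.completion_module T.completion_ip
      (Inr (T.embed (?e x)) :: 'u + _) (Inr (T.embed (?e y))) = sqrt (N x y)" for x y
    by (simp add: T.ip_dist_embed)
  have carrier: "(Inr (T.embed (?e x)) :: 'u + _) \<in> carrier T.completion_module" for x
    by (simp add: T.completion_module_def T.completion_embed)
  show thesis by (rule that[OF T.Hilbert_space_completion carrier dist])
qed

text \<open>\<open>comb\<close> provides the combination of the \<open>f x\<close> with weights
  \<open>c\<close>, described by its inner products; its squared norm is the quadratic form.
  Polarisation then leads from inner products to squared distances.\<close>

lemma (in real_inner_product_space) neg_type_ip_dist:
  fixes f :: "'x \<Rightarrow> 'h"
  assumes f: "\<And>x. f x \<in> carrier V"
  shows "neg_type_on UNIV (\<lambda>x y. (ip_dist V ip (f x) (f y))\<^sup>2)"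
proof -
  have comb: "\<exists>v\<in>carrier V. \<forall>w\<in>carrier V. ip v w = (\<Sum>x\<in>F. c x * ip (f x) w)" if "finite F" for F c
    using that
  proof (induction F rule: finite_induct)
    case empty
    then show ?case by (intro bexI[of _ \<zero>]) (auto simp: ip_zero_left)
  next
    case (insert x F)
    then obtain v where v: "v \<in> carrier V" "\<forall>w\<in>carrier V. ip v w = (\<Sum>x\<in>F. c x * ip (f x) w)" by blast
    then show ?case
      using insert f smult_in_carrier
      by (intro bexI[of _ "c x \<odot>\<^bsub>V\<^esub> f x \<oplus> v"]) (auto simp: ip_add_left ip_smult_left)
  qed
  have "pos_def_on UNIV (\<lambda>x y. ip (f x) (f y))"
    unfolding pos_def_on_def
  proof (intro conjI allI impI ballI)
    show "ip (f x) (f y) = ip (f y) (f x)" for x y by (intro ip_commute f)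
    fix F :: "'x set" and c :: "'x \<Rightarrow> real" assume F: "finite F"
    obtain v where v: "v \<in> carrier V" "\<And>w. w \<in> carrier V \<Longrightarrow> ip v w = (\<Sum>x\<in>F. c x * ip (f x) w)"
      using comb[OF F] by blast
    have "quad (\<lambda>x y. ip (f x) (f y)) F c = (\<Sum>x\<in>F. c x * (\<Sum>y\<in>F. c y * ip (f y) (f x)))"
      unfolding quad_def sum_distrib_left by (intro sum.cong refl) (simp add: ip_commute f)
    also have "\<dots> = (\<Sum>x\<in>F. c x * ip (f x) v)"
      by (intro sum.cong refl) (simp only: v(2)[OF f, symmetric] ip_commute[OF v(1) f])
    also have "\<dots> = ip v v" using v by simp
    finally show "0 \<le> quad (\<lambda>x y. ip (f x) (f y)) F c" by (simp only: ip_nonneg[OF v(1)])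
  qed
  moreover have "(ip_dist V ip (f x) (f y))\<^sup>2 = ip (f x) (f x) + ip (f y) (f y) - 2 * ip (f x) (f y)" for x y
  proof -
    have "(ip_dist V ip (f x) (f y))\<^sup>2 = ip (f x \<ominus> f y) (f x \<ominus> f y)"
      using f by (simp add: ip_dist_def ip_nonneg)
    also have "\<dots> = ip (f x) (f x) + ip (f y) (f y) - 2 * ip (f x) (f y)"
      using f ip_commute[OF f f, of y x] ip_commute[of "f x" "\<ominus> f y"] ip_commute[of "f y" "\<ominus> f y"]
      by (simp add: M.minus_eq ip_add_left ip_add_right ip_minus_left ip_minus_minus)
    finally show ?thesis .
  qed
  ultimately show ?thesis using neg_type_of_pos_def by simp
qed

section \<open>Coarse and uniform kernels\<close>

text \<open>The control functions are replaced by two uniform conditions, from which they can be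
  rebuilt as suprema and infima.\<close>

definition coarse_kernel :: "('a \<Rightarrow> 'a \<Rightarrow> real) \<Rightarrow> ('a \<Rightarrow> 'a \<Rightarrow> real) \<Rightarrow> bool" where
  "coarse_kernel d N \<longleftrightarrow> neg_type_on UNIV N \<and>
     (\<forall>R. \<exists>C. \<forall>x y. d x y \<le> R \<longrightarrow> N x y \<le> C) \<and> (\<forall>C. \<exists>R. \<forall>x y. R \<le> d x y \<longrightarrow> C \<le> N x y)"

definition uniform_kernel :: "('a \<Rightarrow> 'a \<Rightarrow> real) \<Rightarrow> ('a \<Rightarrow> 'a \<Rightarrow> real) \<Rightarrow> bool" where
  "uniform_kernel d N \<longleftrightarrow> neg_type_on UNIV N \<and>
     (\<forall>\<epsilon>>0. \<exists>\<delta>>0. \<forall>x y. d x y < \<delta> \<longrightarrow> N x y < \<epsilon>) \<and> (\<forall>\<epsilon>>0. \<exists>\<delta>>0. \<forall>x y. N x y < \<delta> \<longrightarrow> d x y < \<epsilon>)"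

text \<open>If \<open>m\<close> is the ceiling of the distance, only the terms with
  \<open>k < m\<close> may escape the geometric bound, and each is at most 1. So the sum is at most
  \<open>m + 2\<close>, hence at most \<open>d x y + 3\<close>. Beyond the thresholds of the first
  \<open>n\<close> terms it is at least \<open>n * c\<close>.\<close>

lemma coarse_kernel_sum:
  fixes N :: "nat \<Rightarrow> 'a \<Rightarrow> 'a \<Rightarrow> real"
  assumes neg: "\<And>k. neg_type_on UNIV (N k)" and le1: "\<And>k x y. N k x y \<le> 1"
    and small: "\<And>k x y. d x y \<le> real k \<Longrightarrow> N k x y \<le> (1/2) ^ k"
    and d: "\<And>x y. 0 \<le> d x y"
    and c: "0 < c" and large: "\<And>k. \<exists>R. \<forall>x y. R \<le> d x y \<longrightarrow> c \<le> N k x y"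
  obtains M where "coarse_kernel d M" "\<And>x y. M x y \<le> d x y + 3"
proof -
  define M where "M x y = suminf (\<lambda>k. N k x y)" for x y
  have nn: "0 \<le> N k x y" for k x y using neg_type_on_nonneg[OF neg] by simp
  have *: "summable (\<lambda>k. N k x y) \<and> M x y \<le> d x y + 3" for x y
  proof -
    define m where "m = nat \<lceil>d x y\<rceil>"
    let ?g = "\<lambda>k. (if k < m then 1 else 0) + (1/2 :: real) ^ k"
    have g1: "(\<lambda>k. if k < m then 1 else 0 :: real) sums (\<Sum>k<m. 1)"
      using sums_If_finite_set[of "{..<m}" "\<lambda>_. 1 :: real"] by simp
    have g2: "(\<lambda>k. (1/2 :: real) ^ k) sums 2" using geometric_sums[of "1/2 :: real"] by simp
    have g: "?g sums (real m + 2)" using sums_add[OF g1 g2] by simp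
    have le: "N k x y \<le> ?g k" for k
    proof (cases "k < m")
      case True
      have "N k x y \<le> 1 + (1/2) ^ k" by (rule order_trans[OF le1]) simp
      then show ?thesis using True by simp
    next
      case False
      then have "d x y \<le> real k" using d by (simp add: m_def not_less ceiling_le_iff nat_le_iff)
      then show ?thesis using small False by simp
    qed
    have summ: "summable (\<lambda>k. N k x y)"
      by (rule summable_comparison_test'[OF sums_summable[OF g], of 0]) (use nn le in simp)
    have "M x y \<le> real m + 2"
      unfolding M_def sums_unique[OF g] by (intro suminf_le le summ sums_summable[OF g])
    moreover have "real m \<le> d x y + 1" using d[of x y] by (simp add: m_def)
    ultimately show ?thesis using summ by simp
  qed
  have "neg_type_on UNIV M"
    unfolding M_def using * by (intro neg_type_suminf neg) auto
  moreover have "\<exists>R. \<forall>x y. R \<le> d x y \<longrightarrow> C \<le> M x y" for C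
  proof -
    obtain n where n: "C < real n * c" using reals_Archimedean3[OF c] by blast
    obtain R where R: "\<And>k x y. R k \<le> d x y \<Longrightarrow> c \<le> N k x y" using large by metis
    have "C \<le> M x y" if "(\<Sum>k<n. \<bar>R k\<bar>) \<le> d x y" for x y
    proof -
      have "c \<le> N k x y" if "k < n" for k
      proof (rule R)
        have "\<bar>R k\<bar> \<le> (\<Sum>k<n. \<bar>R k\<bar>)" using that by (intro member_le_sum) auto
        then show "R k \<le> d x y" using \<open>(\<Sum>k<n. \<bar>R k\<bar>) \<le> d x y\<close> by linarith
      qed
      then have "(\<Sum>k<n. c) \<le> (\<Sum>k<n. N k x y)" by (intro sum_mono) auto
      also have "\<dots> \<le> M x y" unfolding M_def using * nn by (intro sum_le_suminf) auto
      finally show ?thesis using n by simp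
    qed
    then show ?thesis by blast
  qed
  moreover have "\<exists>C. \<forall>x y. d x y \<le> R \<longrightarrow> M x y \<le> C" for R
  proof (intro exI allI impI)
    show "M x y \<le> R + 3" if "d x y \<le> R" for x y using * [of x y] that by simp
  qed
  ultimately show thesis using * by (intro that[of M]) (auto simp: coarse_kernel_def)
qed

lemma one_minus_exp_le: "1 - exp (- t) \<le> (t :: real)"
  using exp_ge_add_one_self[of "- t"] by linarith

text \<open>Scaling by \<open>b k\<close> before truncating makes the term of index \<open>k\<close>
  at most \<open>(1/2) ^ k\<close> at distances up to \<open>k\<close>; as \<open>b k\<close> is
  positive, the term still saturates far away.\<close>

lemma coarse_kernel_affine:
  fixes d :: "'a \<Rightarrow> 'a \<Rightarrow> real"
  assumes N: "coarse_kernel d N" and d: "\<And>x y. 0 \<le> d x y"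
  obtains M where "coarse_kernel d M" "\<And>x y. M x y \<le> d x y + 3"
proof -
  have neg: "neg_type_on UNIV N" using N by (simp add: coarse_kernel_def)
  obtain C where C: "\<And>k x y. d x y \<le> real k \<Longrightarrow> N x y \<le> C k"
  proof -
    have "\<forall>k :: nat. \<exists>C. \<forall>x y. d x y \<le> real k \<longrightarrow> N x y \<le> C" using N unfolding coarse_kernel_def by blast
    then show ?thesis using that by metis
  qed
  define b where "b k = (1/2) ^ k / (\<bar>C k\<bar> + 1)" for k
  have b: "0 < b k" for k by (simp add: b_def add_nonneg_pos)
  show thesis
  proof (rule coarse_kernel_sum[of "\<lambda>k x y. 1 - exp (- (b k * N x y))" d "1/2"])
    show "neg_type_on UNIV (\<lambda>x y. 1 - exp (- (b k * N x y)))" for k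
      using b[of k] by (intro neg_type_one_minus_exp neg_type_scale neg) simp
    show "1 - exp (- (b k * N x y)) \<le> (1/2) ^ k" if "d x y \<le> real k" for k x y
    proof -
      have "1 - exp (- (b k * N x y)) \<le> b k * N x y" by (rule one_minus_exp_le)
      also have "\<dots> \<le> b k * (\<bar>C k\<bar> + 1)"
        using C[OF that] b[of k] by (intro mult_left_mono) auto
      also have "\<dots> = (1/2) ^ k" by (simp add: b_def add_nonneg_pos)
      finally show ?thesis .
    qed
    show "\<exists>R. \<forall>x y. R \<le> d x y \<longrightarrow> 1/2 \<le> 1 - exp (- (b k * N x y))" for k
    proof -
      obtain R where R: "\<And>x y. R \<le> d x y \<Longrightarrow> 1 / b k \<le> N x y"
        using N unfolding coarse_kernel_def by metis
      have "1/2 \<le> 1 - exp (- (b k * N x y))" if "R \<le> d x y" for x y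
      proof -
        \<comment> \<open>Past this distance the exponent is at least 1 and its exponential at least
          2, whence the level 1/2.\<close>
        have "1 \<le> b k * N x y" using R[OF that] b[of k] by (simp add: field_simps)
        then have "2 \<le> exp (b k * N x y)" using exp_ge_add_one_self[of "b k * N x y"] by linarith
        then show ?thesis by (simp add: exp_minus field_simps)
      qed
      then show ?thesis by blast
    qed
  qed (use d in \<open>auto intro: that\<close>)
qed

text \<open>A coarse kernel need not be continuous at the diagonal. Attach a second copy \<open>Inl x\<close> of each point
  to its copy \<open>Inr x\<close> by an edge of length 3/2: the kernel bounded by \<open>d + 3\<close> lives on the \<open>Inr\<close> copies,
  where the path metric is \<open>d + 3\<close>, and Minty's theorem extends it to the \<open>Inl\<close> copies, where that
  metric is \<open>d\<close>.\<close>

lemma coarse_kernel_half_Hoelder: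
  fixes d :: "'a \<Rightarrow> 'a \<Rightarrow> real"
  assumes N: "coarse_kernel d N"
    and d: "\<And>x y. 0 \<le> d x y" "\<And>x. d x x = 0" "\<And>x y. d x y = d y x" "\<And>x y z. d x z \<le> d x y + d y z"
  obtains M where "coarse_kernel d M" "\<And>x y. M x y \<le> d x y"
proof -
  obtain L where L: "coarse_kernel d L" "\<And>x y. L x y \<le> d x y + 3"
    by (rule coarse_kernel_affine[OF N d(1)]) (rule that)
  \<comment> \<open>Each \<open>Inr\<close> end adds 3/2, also when \<open>u = v\<close>, so
    \<open>D (Inr x) (Inr x) = 3\<close>. The triangle inequality survives, as an intermediate
    vertex only adds to the right-hand side.\<close>
  define D where "D u v = d (case_sum id id u) (case_sum id id v)
    + case_sum (\<lambda>_. 0) (\<lambda>_. 3/2) u + case_sum (\<lambda>_. 0) (\<lambda>_. 3/2) v" for u v :: "'a + 'a"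
  have neg: "neg_type_on (range Inr) (\<lambda>u v :: 'a + 'a. L (projr u) (projr v))"
    by (rule neg_type_pullback[OF neg_type_on_subset[OF _ subset_UNIV], where h = projr])
      (use L in \<open>auto simp: coarse_kernel_def inj_on_def\<close>)
  obtain N' where N': "neg_type_on UNIV N'" "\<And>x y. N' (Inr x) (Inr y) = L x y" "\<And>u v. N' u v \<le> D u v"
  proof (rule neg_type_extension[OF neg, of D])
    show "L (projr u) (projr v) \<le> D u v" if "u \<in> range Inr" "v \<in> range Inr" for u v
      using that L by (auto simp: D_def add.commute)
    show "0 \<le> D u v" "D u v = D v u" for u v
      using d by (auto simp: D_def split: sum.split intro!: add_nonneg_nonneg)
    show "D u w \<le> D u v + D v w" for u v w
      using d(4)[of "case_sum id id u" "case_sum id id w" "case_sum id id v"]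
      by (auto simp: D_def split: sum.split)
  qed (use that in auto)
  define M where "M x y = N' (Inl x) (Inl y)" for x y
  have negM: "neg_type_on UNIV M"
    unfolding M_def by (rule neg_type_pullback[OF neg_type_on_subset[OF N'(1) subset_UNIV]]) simp
  have le: "M x y \<le> d x y" for x y using N'(3)[of "Inl x" "Inl y"] by (simp add: M_def D_def)
  \<comment> \<open>The quasi-triangle inequality twice along \<open>Inr x\<close>,
    \<open>Inl x\<close>, \<open>Inl y\<close>, \<open>Inr y\<close>:
    \<open>2 * (3/2) + 2 * (2 * M x y + 2 * (3/2)) = 9 + 4 * M x y\<close>.\<close>
  have ge: "L x y \<le> 9 + 4 * M x y" for x y
  proof -
    have "N' (Inr x) (Inl x) \<le> 3/2" "N' (Inl y) (Inr y) \<le> 3/2"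
      using N'(3)[of "Inr x" "Inl x"] N'(3)[of "Inl y" "Inr y"] d(2) by (simp_all add: D_def)
    moreover have "L x y \<le> 2 * N' (Inr x) (Inl x) + 2 * N' (Inl x) (Inr y)"
      using neg_type_on_quasi_triangle[OF N'(1), of "Inr x" "Inl x" "Inr y"] N'(2) by simp
    moreover have "N' (Inl x) (Inr y) \<le> 2 * M x y + 2 * N' (Inl y) (Inr y)"
      using neg_type_on_quasi_triangle[OF N'(1), of "Inl x" "Inl y" "Inr y"] by (simp add: M_def)
    ultimately show ?thesis by linarith
  qed
  have "\<exists>C. \<forall>x y. d x y \<le> R \<longrightarrow> M x y \<le> C" for R using le order_trans by blast
  moreover have "\<exists>R. \<forall>x y. R \<le> d x y \<longrightarrow> C \<le> M x y" for C
  proof -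
    obtain R where R: "\<And>x y. R \<le> d x y \<Longrightarrow> 9 + 4 * C \<le> L x y"
      using L unfolding coarse_kernel_def by metis
    have "C \<le> M x y" if "R \<le> d x y" for x y using R[OF that] ge[of x y] by linarith
    then show ?thesis by blast
  qed
  ultimately show thesis using negM le by (intro that[of M]) (auto simp: coarse_kernel_def)
qed

text \<open>The scaling hypothesis is what distinguishes the metric of a quasi-Banach space: it turns
  separation at one large scale into separation at all scales, and conversely.\<close>

lemma uniform_kernel_of_coarse:
  fixes d :: "'a::real_vector \<Rightarrow> 'a \<Rightarrow> real"
  assumes N: "coarse_kernel d N"
    and d: "\<And>x y. 0 \<le> d x y" "\<And>x. d x x = 0" "\<And>x y. d x y = d y x" "\<And>x y z. d x z \<le> d x y + d y z"
    and p: "0 < p" "p \<le> 1"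
    and scale: "\<And>a x y. 0 < a \<Longrightarrow> d (a *\<^sub>R x) (a *\<^sub>R y) = a powr p * d x y"
  shows "\<exists>M. uniform_kernel d M"
proof -
  obtain L where L: "coarse_kernel d L" "\<And>x y. L x y \<le> d x y"
    by (rule coarse_kernel_half_Hoelder[OF N d]) (rule that)
  have neg: "neg_type_on UNIV L" using L by (simp add: coarse_kernel_def)
  define T where "T k x y = (1/4) ^ k * L (2 ^ k *\<^sub>R x) (2 ^ k *\<^sub>R y)" for k :: nat and x y
  have negT: "neg_type_on UNIV (T k)" for k
    unfolding T_def
    by (intro neg_type_scale neg_type_pullback[OF neg_type_on_subset[OF neg subset_UNIV]])
      (auto simp: inj_on_def)
  have nn: "0 \<le> T k x y" for k x y using neg_type_on_nonneg[OF negT] by simp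
  have le: "T k x y \<le> (1/2) ^ k * d x y" for k x y
  proof -
    have "(2 ^ k) powr p \<le> (2 ^ k :: real) powr 1" using p by (intro powr_mono) auto
    have "T k x y \<le> (1/4) ^ k * ((2 ^ k) powr p * d x y)"
      unfolding T_def using L(2)[of "2 ^ k *\<^sub>R x" "2 ^ k *\<^sub>R y"] scale[of "2 ^ k" x y]
      by (intro mult_left_mono) auto
    also have "\<dots> \<le> (1/4) ^ k * ((2 ^ k) * d x y)"
      using \<open>(2 ^ k) powr p \<le> (2 ^ k :: real) powr 1\<close> d(1)
      by (intro mult_left_mono mult_right_mono) auto
    also have "\<dots> = (1/2) ^ k * d x y"
      by (simp add: power_mult_distrib[symmetric] flip: mult.assoc)
    finally show ?thesis .
  qed
  have g: "(\<lambda>k. (1/2) ^ k * d x y) sums (2 * d x y)" for x y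
    using sums_mult2[OF geometric_sums[of "1/2 :: real"], of "d x y"] by simp
  have summ: "summable (\<lambda>k. T k x y)" for x y
    by (rule summable_comparison_test'[OF sums_summable[OF g[of x y]], of 0]) (use nn le in simp)
  define M where "M x y = suminf (\<lambda>k. T k x y)" for x y
  have M_le: "M x y \<le> 2 * d x y" for x y
    unfolding M_def sums_unique[OF g[of x y]] by (intro suminf_le le summ sums_summable[OF g])
  have M_ge: "T k x y \<le> M x y" for k x y
    using sum_le_suminf[OF summ, of "{k}" x y] nn by (simp add: M_def)
  have "\<exists>\<delta>>0. \<forall>x y. d x y < \<delta> \<longrightarrow> M x y < \<epsilon>" if "0 < \<epsilon>" for \<epsilon>
  proof (intro exI[of _ "\<epsilon> / 2"] conjI allI impI)
    show "M x y < \<epsilon>" if "d x y < \<epsilon> / 2" for x y using M_le[of x y] that by simp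
  qed (use that in simp)
  moreover have "\<exists>\<delta>>0. \<forall>x y. M x y < \<delta> \<longrightarrow> d x y < \<epsilon>" if \<epsilon>: "0 < \<epsilon>" for \<epsilon>
  proof -
    obtain R where R: "\<And>x y. R \<le> d x y \<Longrightarrow> 1 \<le> L x y" using L unfolding coarse_kernel_def by metis
    have "1 < (2 :: real) powr p" using p by simp
    \<comment> \<open>With this \<open>k\<close>, dilation by \<open>2 ^ k\<close> brings pairs at
      distance at least \<open>\<epsilon>\<close> to distance at least \<open>R\<close>, where
      \<open>L\<close> is at least 1; the term of index \<open>k\<close> alone then keeps
      \<open>M\<close> at or above \<open>(1/4) ^ k\<close>.\<close>
    then obtain k where k: "R / \<epsilon> < (2 powr p) ^ k" using real_arch_pow by blast
    have "(2 powr p) ^ k = (2 ^ k :: real) powr p"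
      by (simp add: powr_power flip: powr_realpow) (simp add: powr_powr mult.commute)
    then have k': "R < (2 ^ k) powr p * \<epsilon>" using k \<epsilon> by (simp add: pos_divide_less_eq)
    have "d x y < \<epsilon>" if "M x y < (1/4) ^ k" for x y
    proof (rule ccontr)
      assume "\<not> d x y < \<epsilon>"
      then have "(2 ^ k) powr p * \<epsilon> \<le> d (2 ^ k *\<^sub>R x) (2 ^ k *\<^sub>R y)"
        by (simp add: scale)
      then have "1 \<le> L (2 ^ k *\<^sub>R x) (2 ^ k *\<^sub>R y)" using k' by (intro R) simp
      then have "(1/4) ^ k \<le> T k x y" unfolding T_def using mult_left_mono[of 1 _ "(1/4) ^ k"] by simp
      then show False using M_ge[of k x y] that by simp
    qed
    then show ?thesis by (intro exI[of _ "(1/4) ^ k"]) auto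
  qed
  moreover have "neg_type_on UNIV M" unfolding M_def by (intro neg_type_suminf negT summ)
  ultimately show ?thesis unfolding uniform_kernel_def by blast
qed

text \<open>\<open>a k\<close> shrinks distances up to \<open>k\<close> into the range where
  \<open>N\<close> is below \<open>(1/2) ^ k\<close>. Pairs far enough apart are still at distance
  at least 1 after this dilation, where \<open>N\<close> is at least a fixed
  \<open>\<delta>\<close>.\<close>

lemma coarse_kernel_of_uniform:
  fixes d :: "'a::real_vector \<Rightarrow> 'a \<Rightarrow> real"
  assumes N: "uniform_kernel d N" and d: "\<And>x y. 0 \<le> d x y" and p: "0 < p"
    and scale: "\<And>a x y. 0 < a \<Longrightarrow> d (a *\<^sub>R x) (a *\<^sub>R y) = a powr p * d x y"
  shows "\<exists>M. coarse_kernel d M"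
proof -
  have neg: "neg_type_on UNIV N" using N by (simp add: uniform_kernel_def)
  have "\<exists>a>0. \<forall>x y. d x y \<le> real k \<longrightarrow> N (a *\<^sub>R x) (a *\<^sub>R y) < (1/2) ^ k" for k
  proof -
    have "(0 :: real) < (1/2) ^ k" by simp
    then obtain \<delta> where \<delta>: "0 < \<delta>" "\<And>x y. d x y < \<delta> \<Longrightarrow> N x y < (1/2) ^ k"
      using N unfolding uniform_kernel_def by blast
    \<comment> \<open>Chosen so that distances are multiplied by \<open>\<delta> / (k + 1)\<close>;
      the \<open>+ 1\<close> gives strict inequality at distance \<open>k\<close> and covers
      \<open>k = 0\<close>.\<close>
    define a where "a = (\<delta> / (real k + 1)) powr (1 / p)"
    have a: "0 < a" "a powr p = \<delta> / (real k + 1)"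
      using \<delta> p by (simp_all add: a_def powr_powr)
    have "N (a *\<^sub>R x) (a *\<^sub>R y) < (1/2) ^ k" if "d x y \<le> real k" for x y
    proof (rule \<delta>(2))
      have "\<delta> * d x y < \<delta> * (real k + 1)" using \<delta> that by (intro mult_strict_left_mono) auto
      moreover have "d (a *\<^sub>R x) (a *\<^sub>R y) = \<delta> * d x y / (real k + 1)" using a by (simp add: scale)
      ultimately show "d (a *\<^sub>R x) (a *\<^sub>R y) < \<delta>" by (simp add: pos_divide_less_eq)
    qed
    then show ?thesis using a by blast
  qed
  then obtain a where a: "\<And>k. 0 < a k"
    "\<And>k x y. d x y \<le> real k \<Longrightarrow> N (a k *\<^sub>R x) (a k *\<^sub>R y) < (1/2) ^ k"
    by metis
  obtain \<delta> where \<delta>: "0 < \<delta>" "\<And>x y. N x y < \<delta> \<Longrightarrow> d x y < 1"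
    using N unfolding uniform_kernel_def by (meson zero_less_one)
  obtain M where "coarse_kernel d M" "\<And>x y. M x y \<le> d x y + 3"
  proof (rule coarse_kernel_sum[of "\<lambda>k x y. 1 - exp (- N (a k *\<^sub>R x) (a k *\<^sub>R y))" d "1 - exp (- \<delta>)"])
    show "neg_type_on UNIV (\<lambda>x y. 1 - exp (- N (a k *\<^sub>R x) (a k *\<^sub>R y)))" for k
      using a(1)[of k]
      by (intro neg_type_one_minus_exp neg_type_pullback[OF neg_type_on_subset[OF neg subset_UNIV]])
        (auto simp: inj_on_def)
    show "1 - exp (- N (a k *\<^sub>R x) (a k *\<^sub>R y)) \<le> (1/2) ^ k" if "d x y \<le> real k" for k x y
      using a(2)[OF that] one_minus_exp_le[of "N (a k *\<^sub>R x) (a k *\<^sub>R y)"] by simp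
    show "\<exists>R. \<forall>x y. R \<le> d x y \<longrightarrow> 1 - exp (- \<delta>) \<le> 1 - exp (- N (a k *\<^sub>R x) (a k *\<^sub>R y))" for k
    proof (intro exI allI impI)
      fix x y assume "1 / (a k) powr p \<le> d x y"
      then have "1 \<le> d (a k *\<^sub>R x) (a k *\<^sub>R y)" using a(1)[of k] by (simp add: scale field_simps)
      then have "\<delta> \<le> N (a k *\<^sub>R x) (a k *\<^sub>R y)" using \<delta>(2) by (meson not_less)
      then show "1 - exp (- \<delta>) \<le> 1 - exp (- N (a k *\<^sub>R x) (a k *\<^sub>R y))" by simp
    qed
  qed (use d \<delta> that in auto)
  then show ?thesis by blast
qed

section \<open>Embeddings and kernels\<close>

lemma (in real_inner_product_space) mspace_Hilbert_metric: "mspace (Hilbert_metric V ip) = carrier V"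
  unfolding Hilbert_metric_def by (rule Metric_space.mspace_metric[OF Metric_space_ip_dist])

lemma (in real_inner_product_space) mdist_Hilbert_metric: "mdist (Hilbert_metric V ip) = ip_dist V ip"
  unfolding Hilbert_metric_def by (rule Metric_space.mdist_metric[OF Metric_space_ip_dist])

lemma coarse_kernel_of_embedding:
  fixes m :: "'a metric"
  assumes m: "mspace m = UNIV" and "coarsely_embeds_Hilbert TYPE('u) m"
  shows "\<exists>N. coarse_kernel (mdist m) N"
proof -
  obtain V :: "(real, 'u + ('a \<Rightarrow> real)) module" and ip f
    where V: "real_Hilbert_space V ip" and f: "coarse_embedding m (Hilbert_metric V ip) f"
    using assms(2) unfolding coarsely_embeds_Hilbert_def by blast
  interpret real_Hilbert_space V ip by (rule V)
  let ?D = "\<lambda>x y. ip_dist V ip (f x) (f y)"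
  obtain g h where g: "mono_on {0..} g" "filterlim g at_top at_top" and h: "mono_on {0..} h"
    and gh: "\<And>x y. g (mdist m x y) \<le> ?D x y \<and> ?D x y \<le> h (mdist m x y)"
    using f unfolding coarse_embedding_def m mdist_Hilbert_metric by blast
  have fV: "f x \<in> carrier V" for x
    using f unfolding coarse_embedding_def m mspace_Hilbert_metric by blast
  have D0: "0 \<le> ?D x y" for x y by (simp add: ip_dist_def fV ip_nonneg)
  have "\<exists>C. \<forall>x y. mdist m x y \<le> R \<longrightarrow> (?D x y)\<^sup>2 \<le> C" for R
  proof (intro exI allI impI)
    fix x y assume "mdist m x y \<le> R"
    \<comment> \<open>\<open>h\<close> is monotone on the nonnegative reals only and
      \<open>R\<close> may be negative, hence \<open>\<bar>R\<bar>\<close>.\<close>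
    then have "h (mdist m x y) \<le> h \<bar>R\<bar>" by (intro mono_onD[OF h]) auto
    then have "?D x y \<le> h \<bar>R\<bar>" using gh[of x y] by linarith
    then show "(?D x y)\<^sup>2 \<le> (h \<bar>R\<bar>)\<^sup>2" using D0 by (intro power_mono) auto
  qed
  moreover have "\<exists>R. \<forall>x y. R \<le> mdist m x y \<longrightarrow> C \<le> (?D x y)\<^sup>2" for C
  proof -
    \<comment> \<open>The summand 1 makes the image distance at least 1, hence at most its
      square.\<close>
    have "eventually (\<lambda>t. \<bar>C\<bar> + 1 \<le> g t) at_top"
      using g(2) unfolding filterlim_at_top by blast
    then obtain R where R: "\<And>t. R \<le> t \<Longrightarrow> \<bar>C\<bar> + 1 \<le> g t" unfolding eventually_at_top_linorder by blast
    have "C \<le> (?D x y)\<^sup>2" if "R \<le> mdist m x y" for x y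
    proof -
      have "\<bar>C\<bar> + 1 \<le> ?D x y" using R[OF that] gh[of x y] by linarith
      moreover from this have "?D x y * 1 \<le> ?D x y * ?D x y" using D0 by (intro mult_left_mono) auto
      ultimately show ?thesis by (simp add: power2_eq_square)
    qed
    then show ?thesis by blast
  qed
  ultimately have "coarse_kernel (mdist m) (\<lambda>x y. (?D x y)\<^sup>2)"
    using neg_type_ip_dist[of f, OF fV] unfolding coarse_kernel_def by blast
  then show ?thesis by blast
qed

text \<open>The control functions are extremal: an infimum of image distances over pairs at distance
  at least \<open>t\<close>, and a supremum over pairs at distance at most \<open>t\<close>.\<close>

lemma coarsely_embeds_of_kernel:
  fixes m :: "'a metric"
  assumes m: "mspace m = UNIV" and N: "coarse_kernel (mdist m) N"
  shows "coarsely_embeds_Hilbert TYPE('u) m"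
proof -
  have neg: "neg_type_on UNIV N" using N by (simp add: coarse_kernel_def)
  obtain V :: "(real, 'u + ('a \<Rightarrow> real)) module" and ip f where V: "real_Hilbert_space V ip"
    and fV: "\<And>x. f x \<in> carrier V" and dist: "\<And>x y. ip_dist V ip (f x) (f y) = sqrt (N x y)"
    by (rule neg_type_realization[OF neg]) (rule that)
  interpret real_Hilbert_space V ip by (rule V)
  have nn: "0 \<le> N x y" for x y using neg_type_on_nonneg[OF neg] by simp
  have N0: "N x x = 0" for x using neg by (simp add: neg_type_on_def)
  have m0: "mdist m x x = 0" for x using mdist_zero[of x m x] m by simp
  \<comment> \<open>Inserting \<open>t\<close> keeps the set nonempty when no pair is that far
    apart; as \<open>t\<close> itself grows, the infimum still tends to infinity.\<close>
  define A where "A t = insert t {sqrt (N x y) | x y. t \<le> mdist m x y}" for t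
  define B where "B t = {sqrt (N x y) | x y. mdist m x y \<le> t}" for t
  have bddA: "bdd_below (A t)" if "0 \<le> t" for t
    using that nn by (intro bdd_belowI[of _ 0]) (auto simp: A_def)
  have bddB: "bdd_above (B t)" for t
  proof -
    obtain C where C: "\<And>x y. mdist m x y \<le> t \<Longrightarrow> N x y \<le> C" using N unfolding coarse_kernel_def by metis
    show ?thesis by (intro bdd_aboveI[of _ "sqrt C"]) (auto simp: B_def C)
  qed
  have B0: "0 \<in> B t" if "0 \<le> t" for t
    using that m0 N0 unfolding B_def by (intro CollectI exI[of _ undefined]) simp
  define g where "g t = Inf (A t)" for t
  define h where "h t = Sup (B t)" for t
  have "g \<in> {0..} \<rightarrow> {0..}"
    using nn by (auto simp: g_def A_def intro!: cInf_greatest)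
  moreover have "h \<in> {0..} \<rightarrow> {0..}"
    using B0 bddB by (auto simp: h_def intro!: cSup_upper)
  moreover have "mono_on {0..} g"
  proof (rule mono_onI)
    fix s t :: real assume st: "s \<in> {0..}" "t \<in> {0..}" "s \<le> t"
    show "g s \<le> g t"
      unfolding g_def
    proof (rule cInf_greatest)
      show "A t \<noteq> {}" by (simp add: A_def)
      fix a assume "a \<in> A t"
      then consider "a = t" | x y where "a = sqrt (N x y)" "t \<le> mdist m x y" by (auto simp: A_def)
      then show "Inf (A s) \<le> a"
      proof cases
        case 1
        have "Inf (A s) \<le> s" using bddA st by (intro cInf_lower) (auto simp: A_def)
        then show ?thesis using 1 st by simp
      next
        case 2
        then have "a \<in> A s" using st unfolding A_def by (intro insertI2 CollectI exI[of _ x] exI[of _ y]) auto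
        then show ?thesis using bddA st by (intro cInf_lower) auto
      qed
    qed
  qed
  moreover have "mono_on {0..} h"
  proof (rule mono_onI)
    fix s t :: real assume st: "s \<in> {0..}" "t \<in> {0..}" "s \<le> t"
    have "B s \<subseteq> B t" using st unfolding B_def by (smt (verit) Collect_mono)
    then show "h s \<le> h t" unfolding h_def using B0[of s] bddB st by (intro cSup_subset_mono) auto
  qed
  moreover have "g (mdist m x y) \<le> sqrt (N x y)" for x y
    unfolding g_def using bddA[of "mdist m x y"] by (intro cInf_lower) (auto simp: A_def)
  moreover have "sqrt (N x y) \<le> h (mdist m x y)" for x y
    unfolding h_def using bddB by (intro cSup_upper) (auto simp: B_def)
  moreover have "filterlim g at_top at_top"
    unfolding filterlim_at_top
  proof
    fix C :: real
    obtain R where R: "\<And>x y. R \<le> mdist m x y \<Longrightarrow> C\<^sup>2 \<le> N x y" using N unfolding coarse_kernel_def by metis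
    have "C \<le> g t" if t: "max C R \<le> t" for t
      unfolding g_def
    proof (rule cInf_greatest)
      show "A t \<noteq> {}" by (simp add: A_def)
      fix a assume "a \<in> A t"
      then consider "a = t" | x y where "a = sqrt (N x y)" "t \<le> mdist m x y" by (auto simp: A_def)
      then show "C \<le> a"
      proof cases
        case 2
        then show ?thesis using R[of x y] t by (auto intro: real_le_rsqrt)
      qed (use t in simp)
    qed
    then show "eventually (\<lambda>t. C \<le> g t) at_top" unfolding eventually_at_top_linorder by blast
  qed
  ultimately have "coarse_embedding m (Hilbert_metric V ip) f"
    unfolding coarse_embedding_def m mspace_Hilbert_metric mdist_Hilbert_metric dist
    using fV by (intro conjI exI[of _ g] exI[of _ h]) auto
  then show ?thesis using V unfolding coarsely_embeds_Hilbert_def by blast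
qed

text \<open>The conditions are the two uniform continuities with image distances squared, so the
  thresholds become \<open>sqrt \<epsilon>\<close> and \<open>\<delta>\<^sup>2\<close>.\<close>

lemma uniform_kernel_of_embedding:
  fixes m :: "'a metric"
  assumes m: "mspace m = UNIV" and "uniformly_embeds_Hilbert TYPE('u) m"
  shows "\<exists>N. uniform_kernel (mdist m) N"
proof -
  obtain V :: "(real, 'u + ('a \<Rightarrow> real)) module" and ip f
    where V: "real_Hilbert_space V ip" and f: "uniform_embedding m (Hilbert_metric V ip) f"
    using assms(2) unfolding uniformly_embeds_Hilbert_def by blast
  interpret real_Hilbert_space V ip by (rule V)
  let ?D = "\<lambda>x y. ip_dist V ip (f x) (f y)"
  have inj: "inj f" and cont: "uniformly_continuous_map m (Hilbert_metric V ip) f"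
    and cont_inv: "uniformly_continuous_map (submetric (Hilbert_metric V ip) (range f)) m (inv_into UNIV f)"
    using f unfolding uniform_embedding_def m by auto
  have fV: "f x \<in> carrier V" for x
    using cont unfolding uniformly_continuous_map_def m mspace_Hilbert_metric by blast
  have D0: "0 \<le> ?D x y" for x y by (simp add: ip_dist_def fV ip_nonneg)
  have "\<exists>\<delta>>0. \<forall>x y. mdist m x y < \<delta> \<longrightarrow> (?D x y)\<^sup>2 < \<epsilon>" if "0 < \<epsilon>" for \<epsilon>
  proof -
    have "0 < sqrt \<epsilon>" using that by simp
    then obtain \<delta> where \<delta>: "0 < \<delta>" "\<And>x y. mdist m x y < \<delta> \<Longrightarrow> ?D x y < sqrt \<epsilon>"
      using cont unfolding uniformly_continuous_map_def m mdist_Hilbert_metric by blast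
    have "(?D x y)\<^sup>2 < \<epsilon>" if "mdist m x y < \<delta>" for x y
      using power_strict_mono[OF \<delta>(2)[OF that] D0, of 2] \<open>0 < \<epsilon>\<close> by simp
    then show ?thesis using \<delta>(1) by blast
  qed
  moreover have "\<exists>\<delta>>0. \<forall>x y. (?D x y)\<^sup>2 < \<delta> \<longrightarrow> mdist m x y < \<epsilon>" if \<epsilon>: "0 < \<epsilon>" for \<epsilon>
  proof -
    have range: "range f \<inter> carrier V = range f" using fV by blast
    have "\<forall>\<epsilon>>0. \<exists>\<delta>>0. \<forall>x\<in>range f. \<forall>y\<in>range f. ip_dist V ip y x < \<delta> \<longrightarrow>
        mdist m (inv_into UNIV f y) (inv_into UNIV f x) < \<epsilon>"
      using cont_inv unfolding uniformly_continuous_map_def mspace_submetric mdist_submetric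
        mspace_Hilbert_metric mdist_Hilbert_metric range by blast
    then obtain \<delta> where \<delta>: "0 < \<delta>" "\<forall>u\<in>range f. \<forall>v\<in>range f. ip_dist V ip v u < \<delta> \<longrightarrow>
        mdist m (inv_into UNIV f v) (inv_into UNIV f u) < \<epsilon>"
      using \<epsilon> by blast
    have "mdist m x y < \<epsilon>" if "(?D x y)\<^sup>2 < \<delta>\<^sup>2" for x y
    proof -
      have "?D x y < \<delta>" using that \<delta>(1) by (intro power2_less_imp_less[OF that]) simp
      then show ?thesis using \<delta>(2)[rule_format, of "f y" "f x"] by (simp add: inv_into_f_f[OF inj])
    qed
    then show ?thesis using \<delta>(1) by (intro exI[of _ "\<delta>\<^sup>2"]) auto
  qed
  ultimately have "uniform_kernel (mdist m) (\<lambda>x y. (?D x y)\<^sup>2)"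
    using neg_type_ip_dist[of f, OF fV] unfolding uniform_kernel_def by blast
  then show ?thesis by blast
qed

lemma uniformly_embeds_of_kernel:
  fixes m :: "'a metric"
  assumes m: "mspace m = UNIV" and N: "uniform_kernel (mdist m) N"
  shows "uniformly_embeds_Hilbert TYPE('u) m"
proof -
  have neg: "neg_type_on UNIV N" using N by (simp add: uniform_kernel_def)
  obtain V :: "(real, 'u + ('a \<Rightarrow> real)) module" and ip f where V: "real_Hilbert_space V ip"
    and fV: "\<And>x. f x \<in> carrier V" and dist: "\<And>x y. ip_dist V ip (f x) (f y) = sqrt (N x y)"
    by (rule neg_type_realization[OF neg]) (rule that)
  interpret real_Hilbert_space V ip by (rule V)
  have nn: "0 \<le> N x y" for x y using neg_type_on_nonneg[OF neg] by simp
  have N0: "N x x = 0" for x using neg by (simp add: neg_type_on_def)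
  have lower: "\<exists>\<delta>>0. \<forall>x y. N x y < \<delta> \<longrightarrow> mdist m x y < \<epsilon>" if "0 < \<epsilon>" for \<epsilon>
    using N that unfolding uniform_kernel_def by blast
  have inj: "inj f"
  proof (rule injI, rule ccontr)
    fix x y assume "f x = f y" "x \<noteq> y"
    then have "sqrt (N x y) = sqrt (N x x)" unfolding dist[symmetric] by simp
    then have "N x y = 0" by (simp add: N0)
    moreover have "0 < mdist m x y"
      using \<open>x \<noteq> y\<close> m mdist_nonneg[of m x y] mdist_zero[of x m y] by (simp add: less_le)
    \<comment> \<open>The lower condition is applied with the distance of the two points as
      \<open>\<epsilon>\<close>: \<open>N x y = 0\<close> would make that distance smaller than
      itself.\<close>
    moreover from this obtain \<delta> where "0 < \<delta>" "N x y < \<delta> \<longrightarrow> mdist m x y < mdist m x y"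
      using lower by meson
    ultimately show False by simp
  qed
  have "uniformly_continuous_map m (Hilbert_metric V ip) f"
    unfolding uniformly_continuous_map_def m mspace_Hilbert_metric mdist_Hilbert_metric dist
  proof (intro conjI allI impI)
    fix \<epsilon> :: real assume \<epsilon>: "0 < \<epsilon>"
    then have "0 < \<epsilon>\<^sup>2" by simp
    then obtain \<delta> where \<delta>: "0 < \<delta>" "\<And>x y. mdist m x y < \<delta> \<Longrightarrow> N x y < \<epsilon>\<^sup>2"
      using N unfolding uniform_kernel_def by blast
    have "sqrt (N x y) < \<epsilon>" if "mdist m x y < \<delta>" for x y
      using \<delta>(2)[OF that] \<epsilon> by (intro real_less_lsqrt nn) auto
    then show "\<exists>\<delta>>0. \<forall>x\<in>UNIV. \<forall>y\<in>UNIV. mdist m y x < \<delta> \<longrightarrow> sqrt (N y x) < \<epsilon>" using \<delta>(1) by blast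
  qed (use fV in auto)
  moreover have "uniformly_continuous_map (submetric (Hilbert_metric V ip) (range f)) m (inv_into UNIV f)"
    unfolding uniformly_continuous_map_def mspace_submetric mdist_submetric mspace_Hilbert_metric
      mdist_Hilbert_metric m
  proof (intro conjI allI impI)
    fix \<epsilon> :: real assume "0 < \<epsilon>"
    then obtain \<delta> where \<delta>: "0 < \<delta>" "\<And>x y. N x y < \<delta> \<Longrightarrow> mdist m x y < \<epsilon>" using lower by blast
    have "mdist m (inv_into UNIV f v) (inv_into UNIV f u) < \<epsilon>"
      if uv: "u \<in> range f" "v \<in> range f" "ip_dist V ip v u < sqrt \<delta>" for u v
    proof -
      obtain x y where "u = f x" "v = f y" using uv by blast
      then show ?thesis using uv(3) \<delta>(2)[of y x] by (simp add: inv_into_f_f[OF inj] dist)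
    qed
    then show "\<exists>\<delta>>0. \<forall>x\<in>range f \<inter> carrier V. \<forall>y\<in>range f \<inter> carrier V.
        ip_dist V ip y x < \<delta> \<longrightarrow> mdist m (inv_into UNIV f y) (inv_into UNIV f x) < \<epsilon>"
      using \<delta>(1) by (intro exI[of _ "sqrt \<delta>"]) auto
  qed simp
  ultimately have "uniform_embedding m (Hilbert_metric V ip) f"
    using inj unfolding uniform_embedding_def m by blast
  then show ?thesis using V unfolding uniformly_embeds_Hilbert_def by blast
qed

theorem mainTheorem2:
  fixes q r :: "'a::real_vector \<Rightarrow> real" and p :: real
  assumes "quasi_Banach q"
    and "Aoki_Rolewicz_renorming q p r"
  shows "uniformly_embeds_Hilbert TYPE('u) (pnorm_metric p r) \<longleftrightarrow>
         coarsely_embeds_Hilbert TYPE('u) (pnorm_metric p r)"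
proof -
  let ?m = "pnorm_metric p r"
  have m: "mspace ?m = UNIV" and d: "mdist ?m = (\<lambda>x y. r (x - y) powr p)"
    unfolding pnorm_metric_def
    by (rule Metric_space.mspace_metric Metric_space.mdist_metric, rule Metric_space_pnorm[OF assms(2)])+
  have p: "0 < p" "p \<le> 1" and hom: "r (c *\<^sub>R x) = \<bar>c\<bar> * r x" and r0: "0 \<le> r x" for c x
    using assms(2) by (simp_all add: Aoki_Rolewicz_renorming_def quasi_norm_def)
  \<comment> \<open>Both directions rest on this link between linear structure and metric: dilation
    by \<open>a\<close> multiplies distances by \<open>a powr p\<close>.\<close>
  have scale: "mdist ?m (a *\<^sub>R x) (a *\<^sub>R y) = a powr p * mdist ?m x y" if "0 < a" for a x y
    using that by (simp add: d hom powr_mult r0 flip: scaleR_diff_right)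
  have tri: "mdist ?m x z \<le> mdist ?m x y + mdist ?m y z" for x y z
    using mdist_triangle[of x ?m y z] m by simp
  show ?thesis
  proof
    assume "uniformly_embeds_Hilbert TYPE('u) ?m"
    then obtain N where "uniform_kernel (mdist ?m) N" using uniform_kernel_of_embedding[OF m] by blast
    then obtain M where "coarse_kernel (mdist ?m) M"
      using coarse_kernel_of_uniform[where d = "mdist ?m", OF _ mdist_nonneg p(1) scale] by blast
    then show "coarsely_embeds_Hilbert TYPE('u) ?m" by (rule coarsely_embeds_of_kernel[OF m])
  next
    assume "coarsely_embeds_Hilbert TYPE('u) ?m"
    then obtain N where "coarse_kernel (mdist ?m) N" using coarse_kernel_of_embedding[OF m] by blast
    moreover have "mdist ?m x x = 0" for x using mdist_zero[of x ?m x] m by simp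
    ultimately obtain M where "uniform_kernel (mdist ?m) M"
      using uniform_kernel_of_coarse[where d = "mdist ?m", OF _ mdist_nonneg _ mdist_commute tri p scale] by blast
    then show "uniformly_embeds_Hilbert TYPE('u) ?m" by (rule uniformly_embeds_of_kernel[OF m])
  qed
qed

end
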